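(* Let $X$ be a nonzero complex Banach space with open unit ball $\mathbb{B}$. Let $\alpha_1=(2-\sqrt3)/2\approx0.133975$, which is a root of $4\alpha^2-8\alpha+1=0$, and let $\alpha\in(0,1)$. Let $f:\mathbb{B}\to\mathbb{C}$ be holomorphic with $f(0)=1$ and suppose $F(z)=zf(z)$ belongs to $\mathcal{S}^*_\alpha(\mathbb{B})$. Then for every $z\in X\setminus\{0\}$ and $l_z\in T(z)$, $$|A_2A_3-A_4|\le\begin{cases}\dfrac{2(3-11\alpha+12\alpha^2-4\alpha^3)}{3}&\text{if }\alpha\in(0,\alpha_1],\\[2mm]\dfrac{2(1-\alpha)}{3\sqrt{\alpha(2-\alpha)}}&\text{if }\alpha\in[\alpha_1,1),\end{cases}$$ where $$A_2=\frac{l_z(D^2F(0)(z^2))}{2!\,\|z\|^2},\quad A_3=\frac{l_z(D^3F(0)(z^3))}{3!\,\|z\|^3},\quad A_4=\frac{l_z(D^4F(0)(z^4))}{4!\,\|z\|^4}.$$ Let $u\in X$ with $\|u\|=1$ and $l_u\in T(u)$. When $\alpha\in(0,\alpha_1]$, one has $(q_5,q_6)\in\Theta_4$ and equality holds for the mapping $$\tilde F_2(z)=\frac{z}{(1-l_u(z))^{2(1-\alpha)}},\qquad z\in\mathbb{B}.$$ When $\alpha\in(\alpha_1,1)$, one has $(q_5,q_6)\in\Theta_8$ and equality is attained by the mapping $$\tilde F_3(z)=z\exp\int_0^{l_u(z)}\frac{2(1-\alpha)(\rho-t)}{t^2-2t\rho+1}\,dt,\qquad z\in\mathbb{B},\qquad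 \rho=\frac1{2\sqrt{\alpha(2-\alpha)}}.$$ Hence the bound is sharp.
   Context: For $z\in X\setminus\{0\}$, $T(z)=\{l_z\in L(X,\mathbb{C}): l_z(z)=\|z\|,\ \|l_z\|=1\}$, where $L(X,\mathbb{C})$ is the space of continuous linear functionals on $X$. $D^nF(0)$ is the $n$-th Fréchet derivative at $0$ and $D^nF(0)(z^n)=D^nF(0)(z,\dots,z)$. A holomorphic mapping $F:\mathbb{B}\to X$ is normalized if $F(0)=0$ and $DF(0)=I$, and locally biholomorphic if $DF(z)$ is invertible with bounded inverse for each $z\in\mathbb{B}$. For $\alpha\in(0,1)$, $\mathcal{S}^*_\alpha(\mathbb{B})$ (starlike mappings of order $\alpha$) is the class of normalized locally biholomorphic $F$ with $$\left|\frac1{\|z\|}l_z([DF(z)]^{-1}F(z))-\frac1{2\alpha}\right|<\frac1{2\alpha}\quad\text{for all }z\in\mathbb{B}\setminus\{0\},\ l_z\in T(z).$$ Equivalently, $\dfrac{\|z\|}{l_z([DF(z)]^{-1}F(z))}\in\Phi(\mathbb{U})$ for all such $z,l_z$, where $\mathbb{U}$ is the open unit disk and $\Phi(\zeta)=\frac{1+(1-2\alpha)\zeta}{1-\zeta}$. Writing $\Phi(\zeta)=1+B_1\zeta+B_2\zeta^2+B_3\zeta^3+\cdots$ for this $\Phi$ (so $B_1=B_2=B_3=2(1-\alpha)$), $q_5=\frac{2B_2}{B_1}$ and $q_6=\frac{B_3-B_1^3}{B_1}$. In $\mathbb{R}^2$ (points $(a,b)$): $\Theta_4=\{|a|\ge\frac12,\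 b\le-\frac23(|a|+1)\}$; $\Theta_8=\{\frac12\le|a|\le2,\ -\frac23(|a|+1)\le b\le\frac4{27}(|a|+1)^3-(|a|+1)\}$. Powers use the principal branch; the integral is along any path in $\mathbb{U}$ from $0$ to $l_u(z)$. "Equality holds for/is attained by" a mapping means that the mapping satisfies the hypotheses on $F$ and that equality holds for it at some $z\in X\setminus\{0\}$ (namely $z=ru$, $0<r<1$). *)

theory Defs
  imports "HOL-Complex_Analysis.Complex_Analysis"
begin

text \<open>
  Complex normed and Banach spaces refine the library's real ones by a compatible multiplication
  with complex scalars.  Hence \<open>has_derivative\<close>, \<open>'a \<Rightarrow>\<^sub>L 'b\<close> etc. stay available; they are
  real-linear, and complex linearity is required separately.
\<close>

class complex_normed_vector = real_normed_vector +
  fixes scaleC :: "complex \<Rightarrow> 'a \<Rightarrow> 'a"  (infixr "*\<^sub>C" 75)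
  assumes scaleC_add_right: "a *\<^sub>C (x + y) = a *\<^sub>C x + a *\<^sub>C y"
    and scaleC_add_left: "(a + b) *\<^sub>C x = a *\<^sub>C x + b *\<^sub>C x"
    and scaleC_scaleC: "a *\<^sub>C (b *\<^sub>C x) = (a * b) *\<^sub>C x"
    and scaleC_of_real: "complex_of_real r *\<^sub>C x = r *\<^sub>R x"
    and norm_scaleC: "norm (a *\<^sub>C x) = cmod a * norm x"

class complex_banach = complex_normed_vector + banach

instantiation complex :: complex_banach
begin
definition scaleC_complex :: "complex \<Rightarrow> complex \<Rightarrow> complex"
  where "scaleC_complex a x = a * x"
instance
  by standard
    (simp_all add: scaleC_complex_def algebra_simps norm_mult scaleR_conv_of_real)
end

definition complex_linear :: "('a::complex_normed_vector \<Rightarrow>\<^sub>L 'b::complex_normed_vector) \<Rightarrow> bool"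
  where "complex_linear L \<longleftrightarrow> (\<forall>c x. blinfun_apply L (c *\<^sub>C x) = c *\<^sub>C blinfun_apply L x)"

definition fholomorphic_on ::
  "('a::complex_normed_vector \<Rightarrow> 'b::complex_normed_vector) \<Rightarrow> 'a set \<Rightarrow> bool"
  (infix "fholomorphic'_on" 50)
  where "F fholomorphic_on S \<longleftrightarrow>
    (\<forall>x\<in>S. \<exists>L. complex_linear L \<and> (F has_derivative blinfun_apply L) (at x))"

text \<open>
  For holomorphic \<open>F\<close> the real Frechet derivative is the complex one.  Iterating \<open>fderiv\<close> gives the
  higher Frechet derivatives with values in \<open>'a \<Rightarrow>\<^sub>L 'b\<close>, \<open>'a \<Rightarrow>\<^sub>L 'a \<Rightarrow>\<^sub>L 'b\<close>, and so on, that is, as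
  bounded multilinear maps in curried form, with respect to the operator norm.
\<close>

definition fderiv ::
  "('a::real_normed_vector \<Rightarrow> 'b::real_normed_vector) \<Rightarrow> 'a \<Rightarrow> 'a \<Rightarrow>\<^sub>L 'b"
  where "fderiv F x = Blinfun (frechet_derivative F (at x))"

definition support_functionals :: "'a::complex_normed_vector \<Rightarrow> ('a \<Rightarrow>\<^sub>L complex) set"
  where "support_functionals z =
    {l. complex_linear l \<and> blinfun_apply l z = complex_of_real (norm z) \<and> norm l = 1}"

definition normalized :: "('a::complex_normed_vector \<Rightarrow> 'a) \<Rightarrow> bool"
  where "normalized F \<longleftrightarrow> F 0 = 0 \<and> fderiv F 0 = id_blinfun"

definition locally_biholomorphic :: "('a::complex_normed_vector \<Rightarrow> 'a) \<Rightarrow> bool"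
  where "locally_biholomorphic F \<longleftrightarrow>
    (\<forall>z\<in>ball 0 1. bij (blinfun_apply (fderiv F z)) \<and>
      bounded_linear (inv (blinfun_apply (fderiv F z))))"

definition starlike_of_order :: "real \<Rightarrow> ('a::complex_normed_vector \<Rightarrow> 'a) set"
  where "starlike_of_order \<alpha> =
    {F. F fholomorphic_on ball 0 1 \<and> normalized F \<and> locally_biholomorphic F \<and>
      (\<forall>z\<in>ball 0 1 - {0}. \<forall>l\<in>support_functionals z.
        cmod (complex_of_real (1 / norm z)
                * blinfun_apply l (inv (blinfun_apply (fderiv F z)) (F z))
              - complex_of_real (1 / (2 * \<alpha>))) < 1 / (2 * \<alpha>))}"

text \<open>The hypotheses on a mapping \<open>F(z) = z f(z)\<close>; only the values on the unit ball matter.\<close>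

definition starlike_scalar_multiple ::
  "real \<Rightarrow> ('a::complex_normed_vector \<Rightarrow> complex) \<Rightarrow> ('a \<Rightarrow> 'a) \<Rightarrow> bool"
  where "starlike_scalar_multiple \<alpha> f F \<longleftrightarrow>
    f fholomorphic_on ball 0 1 \<and> f 0 = 1 \<and> (\<forall>z\<in>ball 0 1. F z = f z *\<^sub>C z) \<and>
    F \<in> starlike_of_order \<alpha>"

definition A2 :: "('a::complex_normed_vector \<Rightarrow> 'a) \<Rightarrow> ('a \<Rightarrow>\<^sub>L complex) \<Rightarrow> 'a \<Rightarrow> complex"
  where "A2 F l z =
    blinfun_apply l (blinfun_apply (blinfun_apply (fderiv (fderiv F) 0) z) z)
      / (fact 2 * complex_of_real (norm z ^ 2))"

definition A3 :: "('a::complex_normed_vector \<Rightarrow> 'a) \<Rightarrow> ('a \<Rightarrow>\<^sub>L complex) \<Rightarrow> 'a \<Rightarrow> complex"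
  where "A3 F l z =
    blinfun_apply l
      (blinfun_apply (blinfun_apply (blinfun_apply (fderiv (fderiv (fderiv F)) 0) z) z) z)
      / (fact 3 * complex_of_real (norm z ^ 3))"

definition A4 :: "('a::complex_normed_vector \<Rightarrow> 'a) \<Rightarrow> ('a \<Rightarrow>\<^sub>L complex) \<Rightarrow> 'a \<Rightarrow> complex"
  where "A4 F l z =
    blinfun_apply l
      (blinfun_apply (blinfun_apply (blinfun_apply (blinfun_apply
        (fderiv (fderiv (fderiv (fderiv F))) 0) z) z) z) z)
      / (fact 4 * complex_of_real (norm z ^ 4))"

definition \<alpha>\<^sub>1 :: real
  where "\<alpha>\<^sub>1 = (2 - sqrt 3) / 2"

definition \<Phi> :: "real \<Rightarrow> complex \<Rightarrow> complex"
  where "\<Phi> \<alpha> \<zeta> = (1 + (1 - 2 * complex_of_real \<alpha>) * \<zeta>) / (1 - \<zeta>)"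

text \<open>The Taylor coefficients are real (see \<open>\<Phi>_coeff\<close> below), so \<open>Re\<close> loses nothing.\<close>

definition B :: "real \<Rightarrow> nat \<Rightarrow> real"
  where "B \<alpha> n = Re (fps_nth (fps_expansion (\<Phi> \<alpha>) 0) n)"

definition q5 :: "real \<Rightarrow> real"
  where "q5 \<alpha> = 2 * B \<alpha> 2 / B \<alpha> 1"

definition q6 :: "real \<Rightarrow> real"
  where "q6 \<alpha> = (B \<alpha> 3 - B \<alpha> 1 ^ 3) / B \<alpha> 1"

definition \<Theta>4 :: "(real \<times> real) set"
  where "\<Theta>4 = {(a, b). \<bar>a\<bar> \<ge> 1/2 \<and> b \<le> - (2/3) * (\<bar>a\<bar> + 1)}"

definition \<Theta>8 :: "(real \<times> real) set"
  where "\<Theta>8 = {(a, b). 1/2 \<le> \<bar>a\<bar> \<and> \<bar>a\<bar> \<le> 2 \<and> - (2/3) * (\<bar>a\<bar> + 1) \<le> b \<and>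
    b \<le> 4/27 * (\<bar>a\<bar> + 1) ^ 3 - (\<bar>a\<bar> + 1)}"

text \<open>Complex \<open>powr\<close> is the principal branch.\<close>

definition extremal_F2 :: "real \<Rightarrow> ('a::complex_normed_vector \<Rightarrow>\<^sub>L complex) \<Rightarrow> 'a \<Rightarrow> 'a"
  where "extremal_F2 \<alpha> l z =
    (1 / ((1 - blinfun_apply l z) powr complex_of_real (2 * (1 - \<alpha>)))) *\<^sub>C z"

definition \<rho> :: "real \<Rightarrow> real"
  where "\<rho> \<alpha> = 1 / (2 * sqrt (\<alpha> * (2 - \<alpha>)))"

definition F3_integrand :: "real \<Rightarrow> complex \<Rightarrow> complex"
  where "F3_integrand \<alpha> t =
    2 * (1 - complex_of_real \<alpha>) * (complex_of_real (\<rho> \<alpha>) - t)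
      / (t\<^sup>2 - 2 * t * complex_of_real (\<rho> \<alpha>) + 1)"

text \<open>
  The integral runs along any path in the unit disk from \<open>0\<close> to \<open>l z\<close>; the argument \<open>\<gamma>\<close> of
  \<open>extremal_F3\<close> is an arbitrary choice of such a path for every \<open>z\<close> in the unit ball.
\<close>

definition integration_paths ::
  "('a::complex_normed_vector \<Rightarrow>\<^sub>L complex) \<Rightarrow> ('a \<Rightarrow> real \<Rightarrow> complex) \<Rightarrow> bool"
  where "integration_paths l \<gamma> \<longleftrightarrow>
    (\<forall>z\<in>ball 0 1. valid_path (\<gamma> z) \<and> path_image (\<gamma> z) \<subseteq> ball 0 1 \<and>
      pathstart (\<gamma> z) = 0 \<and> pathfinish (\<gamma> z) = blinfun_apply l z)"

definition extremal_F3 ::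
  "real \<Rightarrow> ('a::complex_normed_vector \<Rightarrow> real \<Rightarrow> complex) \<Rightarrow> 'a \<Rightarrow> 'a"
  where "extremal_F3 \<alpha> \<gamma> z = exp (contour_integral (\<gamma> z) (F3_integrand \<alpha>)) *\<^sub>C z"

lemma \<Phi>_coeff:
  assumes "n \<ge> 1"
  shows "fps_nth (fps_expansion (\<Phi> \<alpha>) 0) n = complex_of_real (2 * (1 - \<alpha>))"
proof -
  define c where "c = complex_of_real (2 * (1 - \<alpha>))"
  define g :: "complex fps" where "g = 1 + fps_const c * (Abs_fps (\<lambda>_. 1) - 1)"
  have "\<Phi> \<alpha> has_fps_expansion g"
  proof -
    have "(\<lambda>z. 1 + c * (inverse (1 - z) - 1)) has_fps_expansion g"
      unfolding g_def fps_inverse_one_minus_fps_X [symmetric]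
      by (intro fps_expansion_intros) auto
    moreover have "eventually (\<lambda>z. 1 + c * (inverse (1 - z) - 1) = \<Phi> \<alpha> z) (nhds 0)"
    proof -
      have "eventually (\<lambda>z::complex. z \<in> - {1}) (nhds 0)"
        by (intro eventually_nhds_in_open) auto
      then show ?thesis
        by eventually_elim (auto simp: \<Phi>_def c_def field_simps)
    qed
    ultimately show ?thesis
      by (rule has_fps_expansion_cong[THEN iffD1, OF _ refl, rotated])
  qed
  then have "fps_expansion (\<Phi> \<alpha>) 0 = g"
    by (rule fps_expansion_eqI)
  with assms show ?thesis
    by (simp add: g_def c_def)
qed

lemma B_eq: "n \<ge> 1 \<Longrightarrow> B \<alpha> n = 2 * (1 - \<alpha>)"
  by (simp add: B_def \<Phi>_coeff)

lemma support_functionals_scaleR: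
  "r > 0 \<Longrightarrow> support_functionals (r *\<^sub>R z) = support_functionals z"
  by (auto simp: support_functionals_def blinfun.scaleR_right scaleR_conv_of_real)

end

theory Submission imports Defs begin

text \<open>
  The functional is a functional of one complex variable in disguise.  For a unit vector \<open>e\<close> and
  \<open>h(\<zeta>) = f(\<zeta> e)\<close> the mapping restricts to \<open>\<zeta> e \<mapsto> \<zeta> h(\<zeta>) e\<close>, so that \<open>A2\<close>, \<open>A3\<close>, \<open>A4\<close> are the
  Taylor coefficients of \<open>h\<close> (\<open>A_coefficients\<close>).  The derivative of \<open>F\<close> at \<open>\<zeta> e\<close> preserves the line
  \<open>\<complex> e\<close>, and therefore starlikeness of order \<open>\<alpha>\<close> says that \<open>p = 1 + \<zeta> h'/h\<close> satisfies
  \<open>Re p > \<alpha>\<close> on every such line (\<open>starlike_slice\<close>).  Comparing coefficients gives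
  \<open>A2 A3 - A4 = (P\<^sub>1\<^sup>3 - P\<^sub>3) / 3\<close>, in which the second coefficient of \<open>p\<close> has cancelled.

  With \<open>p = \<alpha> + (1 - \<alpha>) q\<close> and \<open>s = (1 - \<alpha>)\<^sup>2\<close> it remains to maximise \<open>|E - 4 s M\<^sup>3|\<close> over
  functions \<open>q\<close> with positive real part and \<open>q 0 = 1\<close>, where \<open>2 M\<close> and \<open>2 E\<close> are the first and
  third coefficients of \<open>q\<close>.  A rotation makes the quantity equal to \<open>4 s Re M\<^sup>3 - Re E\<close> with
  \<open>X = Re M\<close> nonnegative, and testing \<open>q\<close> against nonnegative trigonometric polynomials bounds
  \<open>- Re E\<close> by \<open>3 X - 4 X\<^sup>3\<close> for \<open>X \<ge> 1/2\<close> (\<open>caratheodory_third_coefficient_bound\<close>).  The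
  maximum of \<open>3 X - 4 (1 - s) X\<^sup>3\<close> over \<open>1/2 \<le> X \<le> 1\<close> is attained at \<open>X = 1 / (2 sqrt (1 - s)) = \<rho> \<alpha>\<close>
  as long as this is at most \<open>1\<close>, that is \<open>s \<le> 3/4\<close> or \<open>\<alpha> \<ge> \<alpha>\<^sub>1\<close>, and at \<open>X = 1\<close> otherwise; this
  is the reason for the two cases.  Equality forces the measure representing \<open>q\<close> to live where the
  trigonometric polynomial vanishes, at two conjugate points with real part \<open>\<rho> \<alpha>\<close> or at the
  single point \<open>1\<close>.  Both give the kernel \<open>(1 - \<zeta>\<^sup>2) / (1 - 2 c \<zeta> + \<zeta>\<^sup>2)\<close>, with \<open>c = \<rho> \<alpha>\<close> or \<open>c = 1\<close>,
  and solving \<open>1 + \<zeta> h'/h = \<alpha> + (1 - \<alpha>) q\<close> for \<open>h\<close> yields the two extremal mappings.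

  Two facts of functional analysis enter.  The Hahn-Banach theorem, obtained from minimal sublinear
  functionals, provides the functionals \<open>l\<close> (\<open>support_functionals_nonempty\<close>).  And the iterated
  Frechet derivatives, which are limits in operator norm, exist because the derivative of a
  holomorphic mapping is holomorphic (\<open>fholomorphic_fderiv\<close>), a consequence of Cauchy estimates
  that the same functionals transfer from scalar functions.
\<close>

section \<open>Norming functionals\<close>

definition sublinear :: "('a::real_vector \<Rightarrow> real) \<Rightarrow> bool"
  where "sublinear p \<longleftrightarrow> (\<forall>x y. p (x + y) \<le> p x + p y) \<and> (\<forall>c x. 0 \<le> c \<longrightarrow> p (c *\<^sub>R x) = c * p x)"

lemma sublinear_add: "sublinear p \<Longrightarrow> p (x + y) \<le> p x + p y"
  and sublinear_scale: "sublinear p \<Longrightarrow> 0 \<le> c \<Longrightarrow> p (c *\<^sub>R x) = c * p x"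
  by (auto simp: sublinear_def)

lemma sublinear_zero: "sublinear p \<Longrightarrow> p 0 = 0"
  using sublinear_scale[of p 0 0] by simp

lemma sublinear_minus: "sublinear p \<Longrightarrow> - p (- x) \<le> p x"
  using sublinear_add[of p x "- x"] sublinear_zero[of p] by simp

text \<open>
  Lowering a sublinear functional as far as its value at \<open>y\<close> permits makes it additive in the
  direction of \<open>y\<close>.  A functional that cannot be lowered any more is therefore linear.
\<close>

definition tilt :: "('a::real_vector \<Rightarrow> real) \<Rightarrow> 'a \<Rightarrow> 'a \<Rightarrow> real"
  where "tilt p y x = (INF t\<in>{0..}. p (x + t *\<^sub>R y) - t * p y)"

lemma tilt_lower:
  assumes "sublinear p" "t \<ge> 0"
  shows "- p (- x) \<le> p (x + t *\<^sub>R y) - t * p y"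
  using sublinear_add[OF assms(1), of "x + t *\<^sub>R y" "- x"] sublinear_scale[OF assms, of y]
  by simp

lemma tilt_le:
  assumes "sublinear p" "t \<ge> 0"
  shows "tilt p y x \<le> p (x + t *\<^sub>R y) - t * p y"
  unfolding tilt_def using assms
  by (intro cINF_lower bdd_belowI2[of _ "- p (- x)"] tilt_lower) auto

lemma le_tilt:
  assumes "\<And>t. t \<ge> 0 \<Longrightarrow> c \<le> p (x + t *\<^sub>R y) - t * p y"
  shows "c \<le> tilt p y x"
  unfolding tilt_def using assms by (intro cINF_greatest) auto

lemma sublinear_tilt:
  assumes p: "sublinear p"
  shows "sublinear (tilt p y)"
proof -
  have add: "tilt p y (x + x') \<le> tilt p y x + tilt p y x'" for x x'
  proof -
    have "tilt p y (x + x') \<le> (p (x + t *\<^sub>R y) - t * p y) + (p (x' + t' *\<^sub>R y) - t' * p y)"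
      if "t \<ge> 0" "t' \<ge> 0" for t t'
    proof -
      have "tilt p y (x + x') \<le> p ((x + x') + (t + t') *\<^sub>R y) - (t + t') * p y"
        by (intro tilt_le p) (use that in auto)
      also have "(x + x') + (t + t') *\<^sub>R y = (x + t *\<^sub>R y) + (x' + t' *\<^sub>R y)"
        by (simp add: algebra_simps)
      also have "p \<dots> \<le> p (x + t *\<^sub>R y) + p (x' + t' *\<^sub>R y)"
        by (rule sublinear_add[OF p])
      finally show ?thesis by (simp add: algebra_simps)
    qed
    then have "tilt p y (x + x') - (p (x' + t' *\<^sub>R y) - t' * p y) \<le> tilt p y x" if "t' \<ge> 0" for t'
      using that by (intro le_tilt) (smt (verit))
    then have "tilt p y (x + x') - tilt p y x \<le> tilt p y x'"
      by (intro le_tilt) (smt (verit))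
    then show ?thesis by simp
  qed
  have hom_le: "tilt p y (c *\<^sub>R x) \<le> c * tilt p y x" if "c > 0" for c x
  proof -
    have "tilt p y (c *\<^sub>R x) / c \<le> tilt p y x"
    proof (rule le_tilt)
      fix t :: real assume t: "t \<ge> 0"
      have "tilt p y (c *\<^sub>R x) \<le> p (c *\<^sub>R x + (c * t) *\<^sub>R y) - (c * t) * p y"
        by (intro tilt_le p) (use that t in auto)
      also have "c *\<^sub>R x + (c * t) *\<^sub>R y = c *\<^sub>R (x + t *\<^sub>R y)"
        by (simp add: algebra_simps)
      also have "p \<dots> - (c * t) * p y = c * (p (x + t *\<^sub>R y) - t * p y)"
        using that by (simp add: sublinear_scale[OF p] right_diff_distrib)
      finally show "tilt p y (c *\<^sub>R x) / c \<le> p (x + t *\<^sub>R y) - t * p y"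
        using that by (simp add: field_simps)
    qed
    then show ?thesis using that by (simp add: field_simps)
  qed
  have hom: "tilt p y (c *\<^sub>R x) = c * tilt p y x" if "c \<ge> 0" for c x
  proof (cases "c = 0")
    case True
    have "tilt p y 0 \<le> 0"
      using tilt_le[OF p, of 0 y 0] by (simp add: sublinear_zero[OF p])
    moreover have "0 \<le> tilt p y 0"
      using tilt_lower[OF p, of _ 0 y] by (intro le_tilt) (simp add: sublinear_zero[OF p])
    ultimately show ?thesis using True by simp
  next
    case False
    with that have c: "c > 0" by simp
    have "tilt p y ((1 / c) *\<^sub>R (c *\<^sub>R x)) \<le> (1 / c) * tilt p y (c *\<^sub>R x)"
      by (rule hom_le) (use c in simp)
    with hom_le[OF c, of x] c show ?thesis by (simp add: field_simps)
  qed
  from add hom show ?thesis by (simp add: sublinear_def)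
qed

lemma sublinear_minimal_exists:
  fixes p0 :: "'a::real_vector \<Rightarrow> real"
  assumes p0: "sublinear p0"
  obtains p where "sublinear p" "p \<le> p0" "\<And>q. sublinear q \<Longrightarrow> q \<le> p \<Longrightarrow> q = p"
proof -
  define S where "S = {p. sublinear p \<and> p \<le> p0}"
  have lower: "- p0 (- x) \<le> p x" if "p \<in> S" for p x
    using that sublinear_minus[of p x] le_funD[of p p0 "- x"] by (auto simp: S_def)
  have "\<exists>m\<in>S. \<forall>a\<in>S. a \<le> m \<longrightarrow> a = m"
  proof (rule predicate_Zorn)
    show "partial_order_on S (relation_of (\<lambda>a b. b \<le> a) S)"
      by (rule partial_order_on_relation_ofI) auto
  next
    \<comment> \<open>The pointwise infimum of a chain is sublinear; it is finite because \<open>p0\<close> also bounds the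
      chain from below.\<close>
    fix C assume C: "C \<in> Chains (relation_of (\<lambda>a b. b \<le> a) S)"
    then have CS: "C \<subseteq> S" and total: "\<And>p q. p \<in> C \<Longrightarrow> q \<in> C \<Longrightarrow> p \<le> q \<or> q \<le> p"
      by (auto simp: Chains_def relation_of_def)
    show "\<exists>u\<in>S. \<forall>a\<in>C. u \<le> a"
    proof (cases "C = {}")
      case True
      with p0 show ?thesis by (auto simp: S_def)
    next
      case False
      define u where "u x = (INF p\<in>C. p x)" for x
      have bdd: "bdd_below ((\<lambda>p. p x) ` C)" for x
        by (rule bdd_belowI2[of _ "- p0 (- x)"]) (use CS lower in auto)
      have u_le: "u x \<le> p x" if "p \<in> C" for p x
        unfolding u_def by (rule cINF_lower[OF bdd that])
      have le_u: "c \<le> u x" if "\<And>p. p \<in> C \<Longrightarrow> c \<le> p x" for c x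
        unfolding u_def by (rule cINF_greatest[OF False that])
      have subl: "sublinear p" if "p \<in> C" for p
        using that CS by (auto simp: S_def)
      have add: "u (x + y) \<le> u x + u y" for x y
      proof -
        \<comment> \<open>Here the chain condition enters: subadditivity holds for the smaller of \<open>p\<close> and \<open>q\<close>.\<close>
        have *: "u (x + y) \<le> p x + q y" if pq: "p \<in> C" "q \<in> C" for p q
        proof -
          obtain m where m: "m \<in> C" "m \<le> p" "m \<le> q"
            using total[OF pq] pq by auto
          have "u (x + y) \<le> m x + m y"
            using u_le[OF m(1)] sublinear_add[OF subl[OF m(1)]] order_trans by blast
          also have "\<dots> \<le> p x + q y"
            using m by (intro add_mono) (auto dest: le_funD)
          finally show ?thesis .
        qed
        have "u (x + y) - q y \<le> u x" if "q \<in> C" for q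
          by (rule le_u) (use * that in \<open>smt (verit)\<close>)
        then have "u (x + y) - u x \<le> u y"
          by (intro le_u) (smt (verit))
        then show ?thesis by simp
      qed
      have hom: "u (c *\<^sub>R x) = c * u x" if c: "c \<ge> 0" for c x
      proof -
        have "u (c *\<^sub>R x) = (INF p\<in>C. c * p x)"
          unfolding u_def using c by (intro INF_cong refl sublinear_scale subl)
        also have "\<dots> = c * u x"
        proof (cases "c = 0")
          case True
          then show ?thesis using False by simp
        next
          case nz: False
          show ?thesis
          proof (rule antisym)
            have "(INF p\<in>C. c * p x) / c \<le> u x"
            proof (rule le_u)
              fix p assume p: "p \<in> C"
              have "(INF p\<in>C. c * p x) \<le> c * p x"
                by (rule cINF_lower[OF bdd_belowI2[of _ "c * u x"] p])
                   (use c u_le in \<open>auto intro: mult_left_mono\<close>)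
              then show "(INF p\<in>C. c * p x) / c \<le> p x"
                using c nz by (simp add: field_simps)
            qed
            then show "(INF p\<in>C. c * p x) \<le> c * u x"
              using c nz by (simp add: field_simps)
            show "c * u x \<le> (INF p\<in>C. c * p x)"
              using c u_le False by (intro cINF_greatest mult_left_mono) auto
          qed
        qed
        finally show ?thesis .
      qed
      have "u \<le> p0"
      proof -
        obtain p where "p \<in> C" using False by auto
        then show ?thesis
          using u_le[of p] CS by (force simp: S_def le_fun_def intro: order_trans)
      qed
      with add hom have "u \<in> S" by (auto simp: S_def sublinear_def)
      with u_le show ?thesis by (auto simp: le_fun_def)
    qed
  qed
  then obtain m where "m \<in> S" "\<And>a. a \<in> S \<Longrightarrow> a \<le> m \<Longrightarrow> a = m" by blast
  then show ?thesis
    by (intro that[of m]) (auto simp: S_def intro: order_trans)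
qed

lemma sublinear_dominates_linear:
  fixes p0 :: "'a::real_vector \<Rightarrow> real"
  assumes "sublinear p0"
  obtains u where "linear u" "u \<le> p0"
proof -
  obtain p where p: "sublinear p" "p \<le> p0" and min: "\<And>q. sublinear q \<Longrightarrow> q \<le> p \<Longrightarrow> q = p"
    using sublinear_minimal_exists[OF assms] by blast
  have "tilt p y \<le> p" for y
    using tilt_le[OF p(1), of 0 y] by (auto simp: le_fun_def)
  then have tilt: "tilt p y = p" for y
    by (intro min sublinear_tilt p)
  have add: "p (x + y) = p x + p y" for x y
    using tilt_le[OF p(1), of 1 y x] sublinear_add[OF p(1), of x y] by (simp add: tilt)
  have neg: "p (- x) = - p x" for x
    using add[of x "- x"] sublinear_zero[OF p(1)] by simp
  have "p (c *\<^sub>R x) = c * p x" for c x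
  proof (cases "c \<ge> 0")
    case False
    then show ?thesis
      using sublinear_scale[OF p(1), of "- c" x] neg[of "c *\<^sub>R x"] by simp
  qed (simp add: sublinear_scale[OF p(1)])
  with add have "linear p" by (intro linearI) auto
  with p(2) show ?thesis by (rule that[rotated])
qed

lemma sublinear_norm: "sublinear (norm :: 'a::real_normed_vector \<Rightarrow> real)"
  by (simp add: sublinear_def norm_triangle_ineq)

text \<open>
  The norm tilted at \<open>y\<close> takes the value \<open>- norm y\<close> at \<open>- y\<close>, which forces every linear functional
  below it to be as large as possible at \<open>y\<close>.
\<close>

lemma real_norming_functional:
  fixes y :: "'a::real_normed_vector"
  obtains u :: "'a \<Rightarrow> real" where "linear u" "\<And>x. \<bar>u x\<bar> \<le> norm x" "u y = norm y"
proof -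
  obtain u where u: "linear u" "u \<le> tilt norm y"
    using sublinear_dominates_linear[OF sublinear_tilt[OF sublinear_norm]] by blast
  interpret u: linear u by fact
  have le: "u x \<le> norm x" for x
    using le_funD[OF u(2), of x] tilt_le[OF sublinear_norm, of 0 y x] by simp
  have "\<bar>u x\<bar> \<le> norm x" for x
    using le[of x] le[of "- x"] by (simp add: u.neg)
  moreover have "u (- y) \<le> - norm y"
    using le_funD[OF u(2), of "- y"] tilt_le[OF sublinear_norm, of 1 y "- y"] by simp
  then have "u y = norm y"
    using le[of y] by (simp add: u.neg)
  ultimately show ?thesis using u(1) that by blast
qed

lemma scaleC_one [simp]: "1 *\<^sub>C (x::'a::complex_normed_vector) = x"
  using scaleC_of_real[of 1 x] by simp

lemma scaleC_zero_right [simp]: "c *\<^sub>C (0::'a::complex_normed_vector) = 0"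
  using scaleC_add_right[of c "0::'a" 0] by simp

lemma scaleC_zero_left [simp]: "0 *\<^sub>C (x::'a::complex_normed_vector) = 0"
  using scaleC_add_left[of 0 0 x] by simp

lemma scaleC_minus_left: "(- c) *\<^sub>C (x::'a::complex_normed_vector) = - (c *\<^sub>C x)"
  using scaleC_add_left[of c "- c" x] by (simp add: eq_neg_iff_add_eq_0 add.commute)

lemma scaleC_minus_right: "c *\<^sub>C (- x::'a::complex_normed_vector) = - (c *\<^sub>C x)"
  using scaleC_add_right[of c x "- x"] by (simp add: eq_neg_iff_add_eq_0 add.commute)

lemma scaleC_diff_left: "(a - b) *\<^sub>C (x::'a::complex_normed_vector) = a *\<^sub>C x - b *\<^sub>C x"
  using scaleC_add_left[of a "- b" x] by (simp add: scaleC_minus_left)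

lemma scaleC_diff_right: "c *\<^sub>C (x - y::'a::complex_normed_vector) = c *\<^sub>C x - c *\<^sub>C y"
  using scaleC_add_right[of c x "- y"] by (simp add: scaleC_minus_right)

lemma scaleC_scaleR: "a *\<^sub>C (r *\<^sub>R x) = r *\<^sub>R (a *\<^sub>C (x::'a::complex_normed_vector))"
  by (simp flip: scaleC_of_real add: scaleC_scaleC mult.commute)

lemma scaleR_scaleC: "(r *\<^sub>R a) *\<^sub>C x = r *\<^sub>R (a *\<^sub>C (x::'a::complex_normed_vector))"
  by (metis scaleC_of_real scaleC_scaleC scaleR_conv_of_real)

lemma bounded_bilinear_scaleC:
  "bounded_bilinear ((*\<^sub>C) :: complex \<Rightarrow> 'a::complex_normed_vector \<Rightarrow> 'a)"
  by (rule bounded_bilinear.intro)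
     (auto simp: scaleC_add_left scaleC_add_right scaleR_scaleC scaleC_scaleR norm_scaleC
       intro!: exI[of _ 1])

lemma support_functional_norm_le:
  assumes "l \<in> support_functionals z"
  shows "norm (blinfun_apply l x) \<le> norm x"
  using norm_blinfun[of l x] assms by (simp add: support_functionals_def)

text \<open>
  A norming real functional \<open>u\<close> is the real part of the complex functional
  \<open>x \<mapsto> u x - \<i> u (\<i> x)\<close>; turning a value of the latter onto the positive axis bounds its modulus.
\<close>

lemma support_functionals_nonempty:
  fixes y :: "'a::complex_normed_vector"
  assumes "y \<noteq> 0"
  shows "support_functionals y \<noteq> {}"
proof -
  obtain u :: "'a \<Rightarrow> real" where u: "linear u" "\<And>x. \<bar>u x\<bar> \<le> norm x" "u y = norm y"
    using real_norming_functional[of y] by blast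
  interpret u: linear u by fact
  define L where "L x = Complex (u x) (- u (\<i> *\<^sub>C x))" for x
  have L_add: "L (x + x') = L x + L x'" for x x'
    by (simp add: L_def u.add scaleC_add_right complex_eq_iff)
  have L_scaleR: "L (r *\<^sub>R x) = r *\<^sub>R L x" for r x
    by (simp add: L_def u.scaleR scaleC_scaleR complex_eq_iff)
  have L_i: "L (\<i> *\<^sub>C x) = \<i> * L x" for x
    by (simp add: L_def scaleC_scaleC scaleC_minus_left u.neg complex_eq_iff)
  have L_scaleC: "L (c *\<^sub>C x) = c * L x" for c x
  proof -
    have "c = of_real (Re c) + Im c *\<^sub>R \<i>" by (simp add: complex_eq_iff)
    then have "c *\<^sub>C x = Re c *\<^sub>R x + Im c *\<^sub>R (\<i> *\<^sub>C x)"
      by (metis scaleC_add_left scaleC_of_real scaleR_scaleC)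
    then show ?thesis
      by (simp add: L_add L_scaleR L_i complex_eq_iff)
  qed
  have L_le: "cmod (L x) \<le> norm x" for x
  proof (cases "L x = 0")
    case False
    define c where "c = cnj (L x) / cmod (L x)"
    have "L (c *\<^sub>C x) = cmod (L x)"
      using False complex_norm_square[of "L x"]
      by (simp add: L_scaleC c_def field_simps power2_eq_square)
    then have "cmod (L x) = u (c *\<^sub>C x)" by (auto simp: L_def complex_eq_iff)
    also have "\<dots> \<le> norm (c *\<^sub>C x)" using u(2)[of "c *\<^sub>C x"] by linarith
    also have "\<dots> = norm x" using False by (simp add: norm_scaleC c_def norm_divide)
    finally show ?thesis .
  qed simp
  have bl: "bounded_linear L"
    by (rule bounded_linear_intro[of _ 1]) (auto simp: L_add L_scaleR L_le)
  define l where "l = Blinfun L"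
  have l: "blinfun_apply l x = L x" for x
    by (simp add: l_def bounded_linear_Blinfun_apply[OF bl])
  have "u y \<le> cmod (L y)"
    using abs_Re_le_cmod[of "L y"] by (simp add: L_def)
  then have "cmod (L y) = norm y" using L_le[of y] u(3) by simp
  moreover have Re: "Re (L y) = norm y" by (simp add: L_def u(3))
  ultimately have Ly: "L y = of_real (norm y)"
    using cmod_power2[of "L y"] by (simp add: complex_eq_iff)
  have "norm l \<le> 1"
    by (rule norm_blinfun_bound) (auto simp: l L_le)
  moreover have "norm y \<le> norm l * norm y"
    using norm_blinfun[of l y] by (simp add: l Ly)
  then have "1 \<le> norm l" using assms by simp
  ultimately have "l \<in> support_functionals y"
    by (simp add: support_functionals_def complex_linear_def l Ly L_scaleC scaleC_complex_def)
  then show ?thesis by blast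
qed

section \<open>Smoothness of holomorphic mappings between Banach spaces\<close>

instantiation blinfun :: (real_normed_vector, complex_normed_vector) complex_normed_vector
begin

lift_definition scaleC_blinfun :: "complex \<Rightarrow> 'a \<Rightarrow>\<^sub>L 'b \<Rightarrow> 'a \<Rightarrow>\<^sub>L 'b"
  is "\<lambda>c f x. c *\<^sub>C f x"
  by (rule bounded_linear_compose[OF bounded_bilinear.bounded_linear_right[OF bounded_bilinear_scaleC]])

instance
proof
  fix a b :: complex and x y :: "'a \<Rightarrow>\<^sub>L 'b" and r :: real
  show "a *\<^sub>C (x + y) = a *\<^sub>C x + a *\<^sub>C y"
    by transfer (simp add: scaleC_add_right)
  show "(a + b) *\<^sub>C x = a *\<^sub>C x + b *\<^sub>C x"
    by transfer (simp add: scaleC_add_left)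
  show assoc: "a *\<^sub>C b *\<^sub>C x = (a * b) *\<^sub>C x" for a b :: complex and x :: "'a \<Rightarrow>\<^sub>L 'b"
    by transfer (simp add: scaleC_scaleC)
  show "complex_of_real r *\<^sub>C x = r *\<^sub>R x"
    by transfer (simp add: scaleC_of_real)
  have le: "norm (c *\<^sub>C L) \<le> cmod c * norm L" for c and L :: "'a \<Rightarrow>\<^sub>L 'b"
  proof (rule norm_blinfun_bound)
    fix v :: 'a
    show "norm (blinfun_apply (c *\<^sub>C L) v) \<le> cmod c * norm L * norm v"
      using mult_left_mono[OF norm_blinfun[of L v], of "cmod c"]
      by (simp add: scaleC_blinfun.rep_eq norm_scaleC mult.assoc)
  qed simp
  show "norm (a *\<^sub>C x) = cmod a * norm x"
  proof (cases "a = 0")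
    case True
    then show ?thesis using le[of a x] by simp
  next
    case False
    have "x = inverse a *\<^sub>C (a *\<^sub>C x)"
      using False by (simp add: assoc) (transfer, simp)
    then have "norm x \<le> norm (a *\<^sub>C x) / cmod a"
      using le[of "inverse a" "a *\<^sub>C x"] by (simp add: norm_inverse divide_inverse mult.commute)
    then have "cmod a * norm x \<le> norm (a *\<^sub>C x)"
      using False by (simp add: field_simps)
    with le[of a x] show ?thesis by simp
  qed
qed

end

instance blinfun :: (real_normed_vector, complex_banach) complex_banach ..

lemma complex_linearD: "complex_linear L \<Longrightarrow> blinfun_apply L (c *\<^sub>C x) = c *\<^sub>C blinfun_apply L x"
  by (simp add: complex_linear_def)

lemma fderiv_eq: "(F has_derivative blinfun_apply L) (at x) \<Longrightarrow> fderiv F x = L"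
  by (metis fderiv_def frechet_derivative_at blinfun_apply_inverse)

lemma fholomorphic_on_has_derivative:
  "F fholomorphic_on S \<Longrightarrow> x \<in> S \<Longrightarrow> (F has_derivative blinfun_apply (fderiv F x)) (at x)"
  using fderiv_eq unfolding fholomorphic_on_def by metis

lemma fholomorphic_on_complex_linear:
  "F fholomorphic_on S \<Longrightarrow> x \<in> S \<Longrightarrow> complex_linear (fderiv F x)"
  using fderiv_eq unfolding fholomorphic_on_def by metis

lemma fholomorphic_on_subset: "F fholomorphic_on S \<Longrightarrow> T \<subseteq> S \<Longrightarrow> F fholomorphic_on T"
  by (auto simp: fholomorphic_on_def)

lemma fderiv_add:
  assumes "F fholomorphic_on S" "G fholomorphic_on S" "x \<in> S"
  shows "fderiv (\<lambda>y. F y + G y) x = fderiv F x + fderiv G x"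
  using has_derivative_add[OF assms(1,2)[THEN fholomorphic_on_has_derivative, OF assms(3)]]
  by (intro fderiv_eq) (simp add: plus_blinfun.rep_eq)

lemma fderiv_diff:
  assumes "F fholomorphic_on S" "G fholomorphic_on S" "x \<in> S"
  shows "fderiv (\<lambda>y. F y - G y) x = fderiv F x - fderiv G x"
  using has_derivative_diff[OF assms(1,2)[THEN fholomorphic_on_has_derivative, OF assms(3)]]
  by (intro fderiv_eq) (simp add: minus_blinfun.rep_eq)

lemma fderiv_scaleR:
  assumes "F fholomorphic_on S" "x \<in> S"
  shows "fderiv (\<lambda>y. c *\<^sub>R F y) x = c *\<^sub>R fderiv F x"
  using has_derivative_scaleR_right[OF fholomorphic_on_has_derivative[OF assms], of c]
  by (intro fderiv_eq) (simp add: scaleR_blinfun.rep_eq)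

lemma fholomorphic_on_diff:
  assumes "F fholomorphic_on S" "G fholomorphic_on S"
  shows "(\<lambda>y. F y - G y) fholomorphic_on S"
  unfolding fholomorphic_on_def
proof (intro ballI exI conjI)
  fix x assume x: "x \<in> S"
  show "((\<lambda>y. F y - G y) has_derivative blinfun_apply (fderiv F x - fderiv G x)) (at x)"
    using has_derivative_diff[OF assms[THEN fholomorphic_on_has_derivative, OF x]]
    by (simp add: minus_blinfun.rep_eq)
  show "complex_linear (fderiv F x - fderiv G x)"
    using assms[THEN fholomorphic_on_complex_linear, OF x]
    by (simp add: complex_linear_def minus_blinfun.rep_eq scaleC_diff_right)
qed

lemma fholomorphic_on_scaleR:
  assumes "F fholomorphic_on S"
  shows "(\<lambda>y. c *\<^sub>R F y) fholomorphic_on S"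
  unfolding fholomorphic_on_def
proof (intro ballI exI conjI)
  fix x assume x: "x \<in> S"
  show "((\<lambda>y. c *\<^sub>R F y) has_derivative blinfun_apply (c *\<^sub>R fderiv F x)) (at x)"
    using has_derivative_scaleR_right[OF fholomorphic_on_has_derivative[OF assms x], of c]
    by (simp add: scaleR_blinfun.rep_eq)
  show "complex_linear (c *\<^sub>R fderiv F x)"
    using fholomorphic_on_complex_linear[OF assms x]
    by (simp add: complex_linear_def scaleR_blinfun.rep_eq scaleC_scaleR)
qed

lemma fholomorphic_on_translate:
  assumes "F fholomorphic_on S" "\<And>x. x \<in> T \<Longrightarrow> x + k \<in> S"
  shows "(\<lambda>y. F (y + k)) fholomorphic_on T"
  unfolding fholomorphic_on_def
proof (intro ballI exI conjI)
  fix x assume "x \<in> T"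
  then have x: "x + k \<in> S" by (rule assms)
  have "((\<lambda>y. y + k) has_derivative (\<lambda>h. h)) (at x)"
    by (auto intro!: derivative_eq_intros)
  from has_derivative_compose[OF this fholomorphic_on_has_derivative[OF assms(1) x]]
  show "((\<lambda>y. F (y + k)) has_derivative blinfun_apply (fderiv F (x + k))) (at x)" .
  show "complex_linear (fderiv F (x + k))"
    by (rule fholomorphic_on_complex_linear[OF assms(1) x])
qed

lemma fholomorphic_on_locally_bounded:
  assumes F: "F fholomorphic_on S" and "open S" "x \<in> S"
  obtains R M where "R > 0" "M > 0" "ball x R \<subseteq> S" "\<And>y. y \<in> ball x R \<Longrightarrow> norm (F y) \<le> M"
proof -
  obtain R1 where R1: "R1 > 0" "ball x R1 \<subseteq> S"
    using \<open>open S\<close> \<open>x \<in> S\<close> open_contains_ball by blast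
  have "isCont F x"
    using has_derivative_continuous[OF fholomorphic_on_has_derivative[OF F \<open>x \<in> S\<close>]] .
  then obtain d where d: "d > 0" "\<And>y. dist y x < d \<Longrightarrow> dist (F y) (F x) < 1"
    unfolding continuous_at_eps_delta by (meson zero_less_one)
  have "norm (F y) \<le> norm (F x) + 1" if "y \<in> ball x (min R1 d)" for y
    using d(2)[of y] that norm_triangle_sub[of "F y" "F x"]
    by (auto simp: dist_norm norm_minus_commute)
  moreover have "norm (F x) + 1 > 0" by (smt (verit) norm_ge_zero)
  ultimately show ?thesis
    using R1 d(1) by (intro that[of "min R1 d" "norm (F x) + 1"]) auto
qed

lemma slice_has_field_derivative:
  fixes l :: "'b::complex_normed_vector \<Rightarrow> complex"
  assumes F: "F fholomorphic_on S" and x: "x + \<zeta> *\<^sub>C h \<in> S"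
    and l: "bounded_linear l" "\<And>c y. l (c *\<^sub>C y) = c * l y"
  shows "((\<lambda>\<zeta>. l (F (x + \<zeta> *\<^sub>C h)))
    has_field_derivative l (blinfun_apply (fderiv F (x + \<zeta> *\<^sub>C h)) h)) (at \<zeta>)"
proof -
  have "((\<lambda>\<zeta>. x + \<zeta> *\<^sub>C h) has_derivative (\<lambda>k. k *\<^sub>C h)) (at \<zeta>)"
    by (rule has_derivative_add[OF has_derivative_const[of x] bounded_linear_imp_has_derivative[OF
          bounded_bilinear.bounded_linear_left[OF bounded_bilinear_scaleC]], simplified])
  from has_derivative_compose[OF this fholomorphic_on_has_derivative[OF F x]]
  have "((\<lambda>\<zeta>. l (F (x + \<zeta> *\<^sub>C h))) has_derivative
      (\<lambda>k. l (blinfun_apply (fderiv F (x + \<zeta> *\<^sub>C h)) (k *\<^sub>C h)))) (at \<zeta>)"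
    by (rule bounded_linear.has_derivative[OF l(1)])
  then show ?thesis
    by (simp add: has_field_derivative_def l(2)
        complex_linearD[OF fholomorphic_on_complex_linear[OF F x]] mult_commute_abs)
qed

text \<open>
  Cauchy's inequality on the disc of radius \<open>r/2\<close> about \<open>0\<close> gives the first bound; on discs of
  radius \<open>r/4\<close> about the points of modulus at most \<open>r/4\<close> it bounds the second derivative, and
  hence the remainder of the Taylor polynomial.
\<close>

lemma cauchy_linear_approximation:
  assumes \<phi>: "\<phi> holomorphic_on ball 0 r" and r: "r > 0"
    and M: "\<And>\<zeta>. \<zeta> \<in> ball 0 r \<Longrightarrow> cmod (\<phi> \<zeta>) \<le> M"
  shows "cmod (deriv \<phi> 0) \<le> 2 * M / r"
    and "cmod \<zeta> \<le> r / 4 \<Longrightarrow>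
      cmod (\<phi> \<zeta> - \<phi> 0 - \<zeta> * deriv \<phi> 0) \<le> 32 * M / r\<^sup>2 * (cmod \<zeta>)\<^sup>2"
proof -
  have bound: "cmod ((deriv ^^ n) \<phi> \<xi>) \<le> fact n * M / d ^ n"
    if "cmod \<xi> + d < r" "d > 0" for n \<xi> d
  proof (rule Cauchy_inequality)
    have sub: "cball \<xi> d \<subseteq> ball 0 r"
    proof
      fix w assume "w \<in> cball \<xi> d"
      then have "cmod (w - \<xi>) \<le> d" by (simp add: dist_norm norm_minus_commute)
      then show "w \<in> ball 0 r" using that(1) norm_triangle_sub[of w \<xi>] by simp
    qed
    then show "\<phi> holomorphic_on ball \<xi> d" "continuous_on (cball \<xi> d) \<phi>"
      using \<phi> ball_subset_cball
      by (blast intro: holomorphic_on_subset holomorphic_on_imp_continuous_on)+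
    show "cmod (\<phi> w) \<le> M" if "norm (\<xi> - w) = d" for w
      using sub that by (intro M) (auto simp: dist_norm subset_iff)
  qed (use that in auto)
  show "cmod (deriv \<phi> 0) \<le> 2 * M / r"
    using bound[of 0 "r / 2" 1] r by (simp add: mult.commute)
  assume \<zeta>: "cmod \<zeta> \<le> r / 4"
  have "cmod ((deriv ^^ 0) \<phi> \<zeta> - (\<Sum>i\<le>1. (deriv ^^ i) \<phi> 0 * (\<zeta> - 0) ^ i / fact i))
      \<le> 32 * M / r\<^sup>2 * cmod (\<zeta> - 0) ^ Suc 1 / fact 1"
  proof (rule complex_Taylor[where S = "cball 0 (r / 4)" and f = "\<lambda>i. (deriv ^^ i) \<phi>"])
    fix i :: nat and x :: complex assume x: "x \<in> cball 0 (r / 4)"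
    have "(deriv ^^ i) \<phi> holomorphic_on ball 0 r"
      by (intro holomorphic_higher_deriv \<phi>) auto
    then have "((deriv ^^ i) \<phi> has_field_derivative deriv ((deriv ^^ i) \<phi>) x) (at x)"
      by (rule holomorphic_derivI) (use x r in simp_all)
    then show "((deriv ^^ i) \<phi> has_field_derivative (deriv ^^ Suc i) \<phi> x) (at x within cball 0 (r / 4))"
      by (simp add: has_field_derivative_at_within)
    show "cmod ((deriv ^^ Suc 1) \<phi> x) \<le> 32 * M / r\<^sup>2"
      using bound[of x "r / 4" 2] x r by (simp add: numeral_2_eq_2 power2_eq_square field_simps)
  qed (use \<zeta> r in auto)
  then show "cmod (\<phi> \<zeta> - \<phi> 0 - \<zeta> * deriv \<phi> 0) \<le> 32 * M / r\<^sup>2 * (cmod \<zeta>)\<^sup>2"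
    by (simp add: numeral_2_eq_2 algebra_simps)
qed

text \<open>
  Testing with a norming functional turns the vector-valued Cauchy estimates into those for a
  scalar function on a complex line.
\<close>

lemma fholomorphic_cauchy_estimates:
  fixes F :: "'a::complex_normed_vector \<Rightarrow> 'b::complex_normed_vector"
  assumes F: "F fholomorphic_on ball x r" and r: "r > 0"
    and M: "\<And>y. y \<in> ball x r \<Longrightarrow> norm (F y) \<le> M"
  shows "norm (fderiv F x) \<le> 2 * M / r"
    and "norm h \<le> r / 4 \<Longrightarrow>
      norm (F (x + h) - F x - blinfun_apply (fderiv F x) h) \<le> 32 * M / r\<^sup>2 * (norm h)\<^sup>2"
proof -
  have M0: "M \<ge> 0" using order_trans[OF norm_ge_zero M[of x]] r by simp
  have slice: "(\<lambda>\<zeta>. blinfun_apply l (F (x + \<zeta> *\<^sub>C e))) holomorphic_on ball 0 r"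
    "deriv (\<lambda>\<zeta>. blinfun_apply l (F (x + \<zeta> *\<^sub>C e))) 0 = blinfun_apply l (blinfun_apply (fderiv F x) e)"
    "\<And>\<zeta>. \<zeta> \<in> ball 0 r \<Longrightarrow> cmod (blinfun_apply l (F (x + \<zeta> *\<^sub>C e))) \<le> M"
    if e: "norm e = 1" and l: "l \<in> support_functionals v" for e l v
  proof -
    have l': "blinfun_apply l (c *\<^sub>C y) = c * blinfun_apply l y" for c y
      using l by (simp add: support_functionals_def complex_linear_def scaleC_complex_def)
    have in_ball: "x + \<zeta> *\<^sub>C e \<in> ball x r" if "\<zeta> \<in> ball 0 r" for \<zeta>
      using that e by (simp add: dist_norm norm_scaleC)
    note d = slice_has_field_derivative[OF F in_ball blinfun.bounded_linear_right l']
    show "(\<lambda>\<zeta>. blinfun_apply l (F (x + \<zeta> *\<^sub>C e))) holomorphic_on ball 0 r"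
      unfolding holomorphic_on_open[OF open_ball] using d by blast
    show "deriv (\<lambda>\<zeta>. blinfun_apply l (F (x + \<zeta> *\<^sub>C e))) 0
        = blinfun_apply l (blinfun_apply (fderiv F x) e)"
      using d[of 0] r by (intro DERIV_imp_deriv) simp
    show "cmod (blinfun_apply l (F (x + \<zeta> *\<^sub>C e))) \<le> M" if "\<zeta> \<in> ball 0 r" for \<zeta>
      using support_functional_norm_le[OF l] M[OF in_ball[OF that]] order_trans by blast
  qed
  have unit: "norm (blinfun_apply (fderiv F x) e) \<le> 2 * M / r" if e: "norm e = 1" for e
  proof (cases "blinfun_apply (fderiv F x) e = 0")
    case False
    then obtain l where l: "l \<in> support_functionals (blinfun_apply (fderiv F x) e)"
      using support_functionals_nonempty by blast
    show ?thesis
      using cauchy_linear_approximation(1)[OF slice(1)[OF e l] r slice(3)[OF e l]]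
        slice(2)[OF e l] l by (simp add: support_functionals_def)
  qed (use M0 r in auto)
  show "norm (fderiv F x) \<le> 2 * M / r"
  proof (rule norm_blinfun_bound)
    fix k :: 'a
    show "norm (blinfun_apply (fderiv F x) k) \<le> 2 * M / r * norm k"
    proof (cases "k = 0")
      case False
      then show ?thesis
        using unit[of "(1 / norm k) *\<^sub>R k"]
        by (simp add: blinfun.scaleR_right field_simps)
    qed simp
  qed (use M0 r in auto)
  assume h: "norm h \<le> r / 4"
  show "norm (F (x + h) - F x - blinfun_apply (fderiv F x) h) \<le> 32 * M / r\<^sup>2 * (norm h)\<^sup>2"
  proof (cases "F (x + h) - F x - blinfun_apply (fderiv F x) h = 0")
    case False
    then have h0: "h \<noteq> 0" by auto
    define e where "e = (1 / norm h) *\<^sub>R h"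
    have e: "norm e = 1" using h0 by (simp add: e_def)
    have he: "complex_of_real (norm h) *\<^sub>C e = h"
      using h0 by (simp add: e_def scaleC_of_real)
    obtain l where l: "l \<in> support_functionals (F (x + h) - F x - blinfun_apply (fderiv F x) h)"
      using False support_functionals_nonempty by blast
    have "blinfun_apply (fderiv F x) h = norm h *\<^sub>R blinfun_apply (fderiv F x) e"
      using h0 by (simp add: e_def blinfun.scaleR_right)
    then have "cmod (blinfun_apply l (F (x + h) - F x - blinfun_apply (fderiv F x) h))
        \<le> 32 * M / r\<^sup>2 * (norm h)\<^sup>2"
      using cauchy_linear_approximation(2)[OF slice(1)[OF e l] r slice(3)[OF e l], of "norm h"]
        slice(2)[OF e l] h he
      by (simp add: blinfun.diff_right blinfun.scaleR_right scaleR_conv_of_real)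
    then show ?thesis using l by (simp add: support_functionals_def)
  qed (use M0 in auto)
qed

lemma has_derivative_of_quadratic_bound:
  fixes G :: "'a::real_normed_vector \<Rightarrow> 'b::real_normed_vector"
  assumes d: "d > 0"
    and q: "\<And>h. norm h \<le> d \<Longrightarrow> norm (G (x + h) - G x - blinfun_apply L h) \<le> C * (norm h)\<^sup>2"
  shows "(G has_derivative blinfun_apply L) (at x)"
  unfolding has_derivative_at
proof (intro conjI)
  show "(\<lambda>h. norm (G (x + h) - G x - blinfun_apply L h) / norm h) \<midarrow>0\<rightarrow> 0"
  proof (rule Lim_null_comparison)
    have "eventually (\<lambda>h::'a. norm h \<le> d) (at 0)"
      using d by (auto simp: eventually_at intro!: exI[of _ d])
    then show "\<forall>\<^sub>F h in at 0. norm (norm (G (x + h) - G x - blinfun_apply L h) / norm h) \<le> C * norm h"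
    proof eventually_elim
      case (elim h)
      with q[of h] show ?case
        by (cases "h = 0") (auto simp: field_simps power2_eq_square)
    qed
    show "((\<lambda>h::'a. C * norm h) \<longlongrightarrow> 0) (at 0)"
      by (auto intro!: tendsto_eq_intros)
  qed
qed (rule blinfun.bounded_linear_right)

text \<open>
  Weierstrass: the derivatives at \<open>x\<close> converge by the first Cauchy estimate, and the quadratic
  error bound of the second one survives the passage to the limit.
\<close>

lemma fholomorphic_uniform_limit_at:
  fixes F :: "nat \<Rightarrow> 'a::complex_normed_vector \<Rightarrow> 'b::complex_banach"
  assumes F: "\<And>n. F n fholomorphic_on ball x r" and r: "r > 0"
    and M: "\<And>n y. y \<in> ball x r \<Longrightarrow> norm (F n y) \<le> M"
    and lim: "uniform_limit (ball x r) F G sequentially"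
  shows "\<exists>L. complex_linear L \<and> (G has_derivative blinfun_apply L) (at x)"
proof -
  define L where "L n = fderiv (F n) x" for n
  have x: "x \<in> ball x r" using r by simp
  have "Cauchy L"
  proof (rule metric_CauchyI)
    fix \<epsilon> :: real assume \<epsilon>: "\<epsilon> > 0"
    have "uniformly_Cauchy_on (ball x r) F"
      using lim uniformly_convergent_Cauchy uniformly_convergent_on_def by blast
    moreover have "\<epsilon> * r / 4 > 0" using \<epsilon> r by simp
    ultimately obtain N where N:
      "\<forall>y\<in>ball x r. \<forall>m\<ge>N. \<forall>n\<ge>N. dist (F m y) (F n y) < \<epsilon> * r / 4"
      unfolding uniformly_Cauchy_on_def by blast
    have "dist (L m) (L n) < \<epsilon>" if mn: "m \<ge> N" "n \<ge> N" for m n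
    proof -
      have "norm (fderiv (\<lambda>y. F m y - F n y) x) \<le> 2 * (\<epsilon> * r / 4) / r"
      proof (rule fholomorphic_cauchy_estimates(1)[OF fholomorphic_on_diff[OF F F] r])
        show "norm (F m y - F n y) \<le> \<epsilon> * r / 4" if "y \<in> ball x r" for y
          using N mn that unfolding dist_norm by (blast intro: less_imp_le)
      qed
      then show ?thesis
        using \<epsilon> r by (simp add: fderiv_diff[OF F F x] L_def dist_norm)
    qed
    then show "\<exists>N. \<forall>m\<ge>N. \<forall>n\<ge>N. dist (L m) (L n) < \<epsilon>" by blast
  qed
  then obtain D where D: "L \<longlonglongrightarrow> D"
    using Cauchy_convergent convergentD by blast
  have Dapp: "(\<lambda>n. blinfun_apply (L n) h) \<longlonglongrightarrow> blinfun_apply D h" for h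
    by (intro tendsto_intros D)
  have G: "(\<lambda>n. F n y) \<longlonglongrightarrow> G y" if "y \<in> ball x r" for y
    using tendsto_uniform_limitI[OF lim that] .
  have "norm (G (x + h) - G x - blinfun_apply D h) \<le> 32 * M / r\<^sup>2 * (norm h)\<^sup>2"
    if h: "norm h \<le> r / 4" for h
  proof (rule Lim_bounded[where f = "\<lambda>n. norm (F n (x + h) - F n x - blinfun_apply (L n) h)"])
    have "x + h \<in> ball x r" using h r by (simp add: dist_norm)
    then show "(\<lambda>n. norm (F n (x + h) - F n x - blinfun_apply (L n) h))
        \<longlonglongrightarrow> norm (G (x + h) - G x - blinfun_apply D h)"
      by (intro tendsto_intros G x Dapp)
    show "\<forall>n\<ge>0. norm (F n (x + h) - F n x - blinfun_apply (L n) h) \<le> 32 * M / r\<^sup>2 * (norm h)\<^sup>2"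
      unfolding L_def using fholomorphic_cauchy_estimates(2)[OF F r M h] by blast
  qed
  then have "(G has_derivative blinfun_apply D) (at x)"
    using r by (intro has_derivative_of_quadratic_bound[of "r / 4" _ _ _ "32 * M / r\<^sup>2"]) auto
  moreover have "complex_linear D"
    unfolding complex_linear_def
  proof (intro allI)
    fix c h
    have "(\<lambda>n. blinfun_apply (L n) (c *\<^sub>C h)) = (\<lambda>n. c *\<^sub>C blinfun_apply (L n) h)"
      unfolding L_def by (simp add: complex_linearD[OF fholomorphic_on_complex_linear[OF F x]])
    moreover have "(\<lambda>n. c *\<^sub>C blinfun_apply (L n) h) \<longlonglongrightarrow> c *\<^sub>C blinfun_apply D h"
      by (intro bounded_linear.tendsto[OF bounded_bilinear.bounded_linear_right[OF bounded_bilinear_scaleC]] Dapp)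
    ultimately show "blinfun_apply D (c *\<^sub>C h) = c *\<^sub>C blinfun_apply D h"
      using Dapp[of "c *\<^sub>C h"] LIMSEQ_unique by metis
  qed
  ultimately show ?thesis by blast
qed

text \<open>
  The difference quotients in the direction \<open>k\<close> converge uniformly near each point, with an error
  bounded by the second Cauchy estimate.
\<close>

lemma fholomorphic_directional_derivative:
  fixes F :: "'a::complex_normed_vector \<Rightarrow> 'b::complex_banach"
  assumes F: "F fholomorphic_on S" and S: "open S"
  shows "(\<lambda>y. blinfun_apply (fderiv F y) k) fholomorphic_on S"
  unfolding fholomorphic_on_def
proof
  fix x assume x: "x \<in> S"
  obtain R M where R: "R > 0" "M > 0" "ball x R \<subseteq> S" and M: "\<And>y. y \<in> ball x R \<Longrightarrow> norm (F y) \<le> M"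
    using fholomorphic_on_locally_bounded[OF F S x] by blast
  define r where "r = R / 2"
  have r: "r > 0" using R by (simp add: r_def)
  have sub: "ball y r \<subseteq> ball x R" if "y \<in> ball x r" for y
    using that unfolding r_def by (intro subsetI) (metis mem_ball dist_commute dist_triangle_half_l)
  have FR: "F fholomorphic_on ball x R"
    using F R(3) fholomorphic_on_subset by blast
  have Fy: "F fholomorphic_on ball y r" if "y \<in> ball x r" for y
    using FR sub[OF that] fholomorphic_on_subset by blast
  have My: "norm (F w) \<le> M" if "y \<in> ball x r" "w \<in> ball y r" for y w
    using M sub that by blast
  \<comment> \<open>All increments \<open>t n k\<close> stay within a quarter of the radius, where the estimates apply.\<close>
  define c where "c = r / (4 * (norm k + 1))"
  define t where "t n = c / real (Suc n)" for n
  have k1: "norm k + 1 > 0" by (smt (verit) norm_ge_zero)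
  have c: "c > 0" using r k1 by (simp add: c_def)
  have ck: "c * norm k \<le> r / 4"
  proof -
    have "c * norm k = r / 4 * (norm k / (norm k + 1))" using k1 by (simp add: c_def field_simps)
    also have "\<dots> \<le> r / 4 * 1" using k1 r by (intro mult_left_mono) auto
    finally show ?thesis by simp
  qed
  have t: "t n > 0" "t n \<le> c" for n using c by (auto simp: t_def field_simps)
  have tk: "norm (t n *\<^sub>R k) \<le> r / 4" for n
    using mult_right_mono[OF t(2)[of n], of "norm k"] ck t(1)[of n] by simp
  define Q where "Q n y = (1 / t n) *\<^sub>R (F (y + t n *\<^sub>R k) - F y)" for n y
  define K where "K = 32 * M / r\<^sup>2 * (norm k)\<^sup>2"
  have K0: "K \<ge> 0" using R by (simp add: K_def)
  have err: "norm (Q n y - blinfun_apply (fderiv F y) k) \<le> K * t n" if y: "y \<in> ball x r" for n y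
  proof -
    have "Q n y - blinfun_apply (fderiv F y) k =
        (1 / t n) *\<^sub>R (F (y + t n *\<^sub>R k) - F y - blinfun_apply (fderiv F y) (t n *\<^sub>R k))"
      using t(1)[of n] by (simp add: Q_def blinfun.scaleR_right scaleR_diff_right)
    also have "norm \<dots> = norm (F (y + t n *\<^sub>R k) - F y - blinfun_apply (fderiv F y) (t n *\<^sub>R k)) / t n"
      using t(1)[of n] by simp
    also have "\<dots> \<le> (32 * M / r\<^sup>2 * (norm (t n *\<^sub>R k))\<^sup>2) / t n"
      by (rule divide_right_mono[OF fholomorphic_cauchy_estimates(2)[OF Fy[OF y] r My[OF y] tk]])
         (use t(1)[of n] in auto)
    also have "\<dots> = K * t n"
      using t(1)[of n] by (simp add: K_def power_mult_distrib power2_eq_square)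
    finally show ?thesis .
  qed
  show "\<exists>L. complex_linear L \<and> ((\<lambda>y. blinfun_apply (fderiv F y) k) has_derivative blinfun_apply L) (at x)"
  proof (rule fholomorphic_uniform_limit_at[OF _ r])
    show "Q n fholomorphic_on ball x r" for n
      unfolding Q_def
    proof (intro fholomorphic_on_scaleR fholomorphic_on_diff fholomorphic_on_translate[OF FR])
      show "F fholomorphic_on ball x r"
        using Fy[of x] r by simp
      show "y + t n *\<^sub>R k \<in> ball x R" if y: "y \<in> ball x r" for y
      proof -
        have "y + t n *\<^sub>R k \<in> ball y r"
          using tk[of n] r by (simp only: mem_ball dist_norm) (simp add: norm_minus_commute)
        then show ?thesis using sub[OF y] by blast
      qed
    qed
    show "norm (Q n y) \<le> 2 * M / r * norm k + K * c" if y: "y \<in> ball x r" for n y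
    proof -
      have "norm (Q n y) \<le> norm (blinfun_apply (fderiv F y) k) + norm (Q n y - blinfun_apply (fderiv F y) k)"
        by (rule norm_triangle_sub)
      also have "\<dots> \<le> 2 * M / r * norm k + K * c"
      proof (rule add_mono)
        show "norm (blinfun_apply (fderiv F y) k) \<le> 2 * M / r * norm k"
          using norm_blinfun[of "fderiv F y" k]
            mult_right_mono[OF fholomorphic_cauchy_estimates(1)[OF Fy[OF y] r My[OF y]], of "norm k"]
          by simp
        show "norm (Q n y - blinfun_apply (fderiv F y) k) \<le> K * c"
          using err[OF y, of n] mult_left_mono[OF t(2)[of n] K0] by linarith
      qed
      finally show ?thesis .
    qed
    show "uniform_limit (ball x r) Q (\<lambda>y. blinfun_apply (fderiv F y) k) sequentially"
    proof (rule uniform_limitI)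
      fix e :: real assume e: "e > 0"
      have "(\<lambda>n. K * t n) \<longlonglongrightarrow> K * 0"
        unfolding t_def by (intro tendsto_intros real_tendsto_divide_at_top[OF tendsto_const]
            filterlim_compose[OF filterlim_real_sequentially filterlim_Suc])
      then have "eventually (\<lambda>n. K * t n < e) sequentially"
        using e by (intro order_tendstoD) auto
      then show "\<forall>\<^sub>F n in sequentially. \<forall>y\<in>ball x r. dist (Q n y) (blinfun_apply (fderiv F y) k) < e"
      proof eventually_elim
        case (elim n)
        show ?case
          using le_less_trans[OF err elim] by (simp add: dist_norm)
      qed
    qed
  qed
qed

text \<open>
  The second derivative is assembled from the derivatives of all directional derivatives; the
  Cauchy estimates for these are uniform in the direction, which gives convergence in operator norm.
\<close>

theorem fholomorphic_fderiv:
  fixes F :: "'a::complex_normed_vector \<Rightarrow> 'b::complex_banach"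
  assumes F: "F fholomorphic_on S" and S: "open S"
  shows "fderiv F fholomorphic_on S"
  unfolding fholomorphic_on_def
proof
  fix x assume x: "x \<in> S"
  obtain R M where R: "R > 0" "M > 0" "ball x R \<subseteq> S" and M: "\<And>y. y \<in> ball x R \<Longrightarrow> norm (F y) \<le> M"
    using fholomorphic_on_locally_bounded[OF F S x] by blast
  define r where "r = R / 2"
  have r: "r > 0" using R by (simp add: r_def)
  have sub: "ball y r \<subseteq> ball x R" if "y \<in> ball x r" for y
    using that unfolding r_def by (intro subsetI) (metis mem_ball dist_commute dist_triangle_half_l)
  have DF: "norm (fderiv F y) \<le> 2 * M / r" if "y \<in> ball x r" for y
  proof (rule fholomorphic_cauchy_estimates(1)[OF _ r])
    show "F fholomorphic_on ball y r"
      using F R(3) sub[OF that] fholomorphic_on_subset by blast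
    show "norm (F w) \<le> M" if "w \<in> ball y r" for w
      using M sub \<open>y \<in> ball x r\<close> that by blast
  qed
  define G where "G k y = blinfun_apply (fderiv F y) k" for k y
  have GS: "G k fholomorphic_on S" for k
    unfolding G_def by (rule fholomorphic_directional_derivative[OF F S])
  have "ball x r \<subseteq> S" using sub[of x] R(3) r by auto
  then have Gr: "G k fholomorphic_on ball x r" for k
    using GS fholomorphic_on_subset by blast
  have GM: "norm (G k y) \<le> 2 * M / r * norm k" if "y \<in> ball x r" for k y
    unfolding G_def using norm_blinfun[of "fderiv F y" k] mult_right_mono[OF DF[OF that], of "norm k"]
    by simp
  define N where "N = 2 * (2 * M / r) / r"
  have N: "norm (blinfun_apply (fderiv (G k) x) h) \<le> N * norm h * norm k" for k h
  proof -
    have "norm (blinfun_apply (fderiv (G k) x) h) \<le> norm (fderiv (G k) x) * norm h"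
      by (rule norm_blinfun)
    also have "\<dots> \<le> (2 * (2 * M / r * norm k) / r) * norm h"
      by (rule mult_right_mono[OF fholomorphic_cauchy_estimates(1)[OF Gr r GM]]) auto
    finally show ?thesis by (simp add: N_def mult_ac)
  qed
  have blk: "bounded_linear (\<lambda>k. blinfun_apply (fderiv (G k) x) h)" for h
  proof (rule bounded_linear_intro[where K = "N * norm h"])
    fix k k' and c :: real
    have "G (k + k') = (\<lambda>y. G k y + G k' y)" by (simp add: G_def blinfun.add_right fun_eq_iff)
    then show "blinfun_apply (fderiv (G (k + k')) x) h
        = blinfun_apply (fderiv (G k) x) h + blinfun_apply (fderiv (G k') x) h"
      by (simp add: fderiv_add[OF GS GS x] blinfun.add_left)
    have "G (c *\<^sub>R k) = (\<lambda>y. c *\<^sub>R G k y)" by (simp add: G_def blinfun.scaleR_right fun_eq_iff)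
    then show "blinfun_apply (fderiv (G (c *\<^sub>R k)) x) h = c *\<^sub>R blinfun_apply (fderiv (G k) x) h"
      by (simp add: fderiv_scaleR[OF GS x] blinfun.scaleR_left)
    show "norm (blinfun_apply (fderiv (G k) x) h) \<le> norm k * (N * norm h)"
      using N[of k h] by (simp add: mult_ac)
  qed
  define D1 where "D1 h = Blinfun (\<lambda>k. blinfun_apply (fderiv (G k) x) h)" for h
  have D1: "blinfun_apply (D1 h) k = blinfun_apply (fderiv (G k) x) h" for h k
    by (simp add: D1_def bounded_linear_Blinfun_apply[OF blk])
  have blh: "bounded_linear D1"
  proof (rule bounded_linear_intro[where K = N])
    fix h h' and c :: real
    show "D1 (h + h') = D1 h + D1 h'" "D1 (c *\<^sub>R h) = c *\<^sub>R D1 h"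
      by (rule blinfun_eqI; simp add: D1 blinfun.add_left blinfun.add_right
          blinfun.scaleR_left blinfun.scaleR_right)+
    show "norm (D1 h) \<le> norm h * N"
    proof (rule norm_blinfun_bound)
      show "0 \<le> norm h * N" using R r by (simp add: N_def)
      show "norm (blinfun_apply (D1 h) k) \<le> norm h * N * norm k" for k
        using N[of k h] by (simp add: D1 mult_ac)
    qed
  qed
  define D where "D = Blinfun D1"
  have D: "blinfun_apply (blinfun_apply D h) k = blinfun_apply (fderiv (G k) x) h" for h k
    by (simp add: D_def bounded_linear_Blinfun_apply[OF blh] D1)
  show "\<exists>L. complex_linear L \<and> (fderiv F has_derivative blinfun_apply L) (at x)"
  proof (intro exI conjI)
    show "complex_linear D"
      unfolding complex_linear_def
      by (intro allI blinfun_eqI)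
         (simp add: D scaleC_blinfun.rep_eq complex_linearD[OF fholomorphic_on_complex_linear[OF GS x]])
    show "(fderiv F has_derivative blinfun_apply D) (at x)"
    proof (rule has_derivative_of_quadratic_bound[where d = "r / 4"])
      fix h :: 'a assume h: "norm h \<le> r / 4"
      show "norm (fderiv F (x + h) - fderiv F x - blinfun_apply D h)
          \<le> 32 * (2 * M / r) / r\<^sup>2 * (norm h)\<^sup>2"
      proof (rule norm_blinfun_bound)
        fix k
        have "norm (G k (x + h) - G k x - blinfun_apply (fderiv (G k) x) h)
            \<le> 32 * (2 * M / r * norm k) / r\<^sup>2 * (norm h)\<^sup>2"
          by (rule fholomorphic_cauchy_estimates(2)[OF Gr r GM h])
        then show "norm (blinfun_apply (fderiv F (x + h) - fderiv F x - blinfun_apply D h) k)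
            \<le> 32 * (2 * M / r) / r\<^sup>2 * (norm h)\<^sup>2 * norm k"
          by (simp add: blinfun.diff_left D G_def mult_ac)
      qed (use R r in auto)
    qed (use r in auto)
  qed
qed

section \<open>Coefficients along a complex line\<close>

lemma fholomorphic_slice_holomorphic:
  assumes f: "f fholomorphic_on ball 0 1" and e: "norm e = 1"
  shows "(\<lambda>\<zeta>::complex. f (\<zeta> *\<^sub>C e) :: complex) holomorphic_on ball 0 1"
    and "\<zeta> \<in> ball 0 1 \<Longrightarrow> deriv (\<lambda>\<zeta>. f (\<zeta> *\<^sub>C e)) \<zeta> = blinfun_apply (fderiv f (\<zeta> *\<^sub>C e)) e"
proof -
  have d: "((\<lambda>\<zeta>. f (\<zeta> *\<^sub>C e)) has_field_derivative blinfun_apply (fderiv f (\<zeta> *\<^sub>C e)) e) (at \<zeta>)"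
    if "\<zeta> \<in> ball 0 1" for \<zeta>
    using slice_has_field_derivative[OF f, of 0 \<zeta> e "\<lambda>x. x"] that e
    by (simp add: norm_scaleC scaleC_complex_def)
  show "(\<lambda>\<zeta>. f (\<zeta> *\<^sub>C e)) holomorphic_on ball 0 1"
    unfolding holomorphic_on_open[OF open_ball] using d by blast
  show "\<zeta> \<in> ball 0 1 \<Longrightarrow> deriv (\<lambda>\<zeta>. f (\<zeta> *\<^sub>C e)) \<zeta> = blinfun_apply (fderiv f (\<zeta> *\<^sub>C e)) e"
    by (rule DERIV_imp_deriv[OF d])
qed

lemma deriv_eq_on_ball:
  fixes g g' G :: "complex \<Rightarrow> complex"
  assumes "\<And>\<zeta>. \<zeta> \<in> ball 0 1 \<Longrightarrow> (g has_field_derivative g' \<zeta>) (at \<zeta>)"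
    and "\<And>\<zeta>. \<zeta> \<in> ball 0 1 \<Longrightarrow> G \<zeta> = g \<zeta>" and "\<zeta> \<in> ball 0 1"
  shows "deriv G \<zeta> = g' \<zeta>"
proof (rule DERIV_imp_deriv)
  show "(G has_field_derivative g' \<zeta>) (at \<zeta>)"
    using has_field_derivative_transform_within_open[OF assms(1)[OF assms(3)] open_ball assms(3)] assms(2)
    by simp
qed

text \<open>
  Each iterated Frechet derivative is again holomorphic, so applying it to \<open>e\<close> throughout and
  restricting to the line \<open>\<complex> e\<close> amounts to differentiating the restriction.
\<close>

lemma higher_fderiv_slice:
  fixes F :: "'a::complex_normed_vector \<Rightarrow> 'b::complex_banach"
  assumes F: "F fholomorphic_on ball 0 1" and l: "complex_linear l" and e: "norm e = 1"
  defines "G \<equiv> \<lambda>\<zeta>. blinfun_apply l (F (\<zeta> *\<^sub>C e))"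
  shows "(deriv ^^ 2) G 0 = blinfun_apply l (blinfun_apply (blinfun_apply (fderiv (fderiv F) 0) e) e)"
    and "(deriv ^^ 3) G 0 = blinfun_apply l
      (blinfun_apply (blinfun_apply (blinfun_apply (fderiv (fderiv (fderiv F)) 0) e) e) e)"
    and "(deriv ^^ 4) G 0 = blinfun_apply l
      (blinfun_apply (blinfun_apply (blinfun_apply (blinfun_apply
        (fderiv (fderiv (fderiv (fderiv F))) 0) e) e) e) e)"
proof -
  have F1: "fderiv F fholomorphic_on ball 0 1"
    by (rule fholomorphic_fderiv[OF F open_ball])
  have F2: "fderiv (fderiv F) fholomorphic_on ball 0 1"
    by (rule fholomorphic_fderiv[OF F1 open_ball])
  have F3: "fderiv (fderiv (fderiv F)) fholomorphic_on ball 0 1"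
    by (rule fholomorphic_fderiv[OF F2 open_ball])
  have lc: "blinfun_apply l (c *\<^sub>C y) = c * blinfun_apply l y" for c y
    using l by (simp add: complex_linear_def scaleC_complex_def)
  have B: "0 + \<zeta> *\<^sub>C e \<in> ball 0 1" if "\<zeta> \<in> ball 0 1" for \<zeta>
    using that e by (simp add: norm_scaleC)
  note bl = bounded_linear_compose[OF blinfun.bounded_linear_right]
    bounded_linear_compose[OF blinfun.bounded_linear_left] blinfun.bounded_linear_right
    blinfun.bounded_linear_left
  note s0 = slice_has_field_derivative[OF F B, where l = "\<lambda>y. blinfun_apply l y"]
  note s1 = slice_has_field_derivative[OF F1 B, where l = "\<lambda>y. blinfun_apply l (blinfun_apply y e)"]
  note s2 = slice_has_field_derivative[OF F2 B,
      where l = "\<lambda>y. blinfun_apply l (blinfun_apply (blinfun_apply y e) e)"]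
  note s3 = slice_has_field_derivative[OF F3 B,
      where l = "\<lambda>y. blinfun_apply l (blinfun_apply (blinfun_apply (blinfun_apply y e) e) e)"]
  have d1: "deriv G \<zeta> = blinfun_apply l (blinfun_apply (fderiv F (\<zeta> *\<^sub>C e)) e)"
    if "\<zeta> \<in> ball 0 1" for \<zeta>
    by (rule deriv_eq_on_ball[OF _ _ that], rule s0[simplified])
       (auto simp: G_def lc intro!: bl)
  have d2: "deriv (deriv G) \<zeta> = blinfun_apply l (blinfun_apply (blinfun_apply (fderiv (fderiv F) (\<zeta> *\<^sub>C e)) e) e)"
    if "\<zeta> \<in> ball 0 1" for \<zeta>
    by (rule deriv_eq_on_ball[OF _ _ that], rule s1[simplified])
       (auto simp: d1 lc scaleC_blinfun.rep_eq intro!: bl)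
  have d3: "deriv (deriv (deriv G)) \<zeta> = blinfun_apply l
      (blinfun_apply (blinfun_apply (blinfun_apply (fderiv (fderiv (fderiv F)) (\<zeta> *\<^sub>C e)) e) e) e)"
    if "\<zeta> \<in> ball 0 1" for \<zeta>
    by (rule deriv_eq_on_ball[OF _ _ that], rule s2[simplified])
       (auto simp: d2 lc scaleC_blinfun.rep_eq intro!: bl)
  have d4: "deriv (deriv (deriv (deriv G))) \<zeta> = blinfun_apply l
      (blinfun_apply (blinfun_apply (blinfun_apply (blinfun_apply
        (fderiv (fderiv (fderiv (fderiv F))) (\<zeta> *\<^sub>C e)) e) e) e) e)"
    if "\<zeta> \<in> ball 0 1" for \<zeta>
    by (rule deriv_eq_on_ball[OF _ _ that], rule s3[simplified])
       (auto simp: d3 lc scaleC_blinfun.rep_eq intro!: bl)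
  show "(deriv ^^ 2) G 0 = blinfun_apply l (blinfun_apply (blinfun_apply (fderiv (fderiv F) 0) e) e)"
    "(deriv ^^ 3) G 0 = blinfun_apply l
      (blinfun_apply (blinfun_apply (blinfun_apply (fderiv (fderiv (fderiv F)) 0) e) e) e)"
    "(deriv ^^ 4) G 0 = blinfun_apply l
      (blinfun_apply (blinfun_apply (blinfun_apply (blinfun_apply
        (fderiv (fderiv (fderiv (fderiv F))) 0) e) e) e) e)"
    using d2[of 0] d3[of 0] d4[of 0] by (simp_all add: eval_nat_numeral)
qed

lemma A_coefficients:
  fixes F :: "'a::complex_banach \<Rightarrow> 'a"
  assumes F: "F fholomorphic_on ball 0 1" and f: "f fholomorphic_on ball 0 1"
    and Ff: "\<And>z. z \<in> ball 0 1 \<Longrightarrow> F z = f z *\<^sub>C z"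
    and l: "l \<in> support_functionals e" and e: "norm e = 1"
  defines "H \<equiv> fps_expansion (\<lambda>\<zeta>. f (\<zeta> *\<^sub>C e)) 0"
  shows "A2 F l e = fps_nth H 1" "A3 F l e = fps_nth H 2" "A4 F l e = fps_nth H 3"
proof -
  have ll: "complex_linear l" and le: "blinfun_apply l e = 1"
    using l e by (auto simp: support_functionals_def)
  have hH: "(\<lambda>\<zeta>. f (\<zeta> *\<^sub>C e)) has_fps_expansion H"
    unfolding H_def
    by (rule has_fps_expansion_fps_expansion[OF open_ball _ fholomorphic_slice_holomorphic(1)[OF f e]]) simp
  define G where "G = (\<lambda>\<zeta>. blinfun_apply l (F (\<zeta> *\<^sub>C e)))"
  have G: "G \<zeta> = \<zeta> * f (\<zeta> *\<^sub>C e)" if "\<zeta> \<in> ball 0 1" for \<zeta>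
    using that e Ff[of "\<zeta> *\<^sub>C e"]
    by (simp add: G_def norm_scaleC complex_linearD[OF ll] scaleC_complex_def le)
  have "eventually (\<lambda>\<zeta>. \<zeta> * f (\<zeta> *\<^sub>C e) = G \<zeta>) (nhds 0)"
    using G eventually_nhds_in_open[OF open_ball, of "0::complex" 0 1]
    by (auto elim: eventually_mono)
  then have "G has_fps_expansion fps_X * H"
    using has_fps_expansion_cong[THEN iffD1, OF _ refl has_fps_expansion_mult[OF has_fps_expansion_fps_X hH]]
    by blast
  then have c: "(deriv ^^ Suc n) G 0 / fact (Suc n) = fps_nth H n" for n
    by (simp flip: fps_nth_fps_expansion add: fps_X_mult_nth del: fact_Suc funpow.simps)
  note s = higher_fderiv_slice[OF F ll e, folded G_def]
  show "A2 F l e = fps_nth H 1"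
    using c[of 1] s(1) e by (simp add: A2_def numeral_2_eq_2 del: funpow.simps fact_Suc)
  show "A3 F l e = fps_nth H 2"
    using c[of 2] s(2) e by (simp add: A3_def eval_nat_numeral del: funpow.simps fact_Suc)
  show "A4 F l e = fps_nth H 3"
    using c[of 3] s(3) e by (simp add: A4_def eval_nat_numeral del: funpow.simps fact_Suc)
qed

lemma A_scaleR:
  fixes F :: "'a::complex_normed_vector \<Rightarrow> 'a"
  assumes "r > 0"
  shows "A2 F l (r *\<^sub>R z) = A2 F l z" "A3 F l (r *\<^sub>R z) = A3 F l z" "A4 F l (r *\<^sub>R z) = A4 F l z"
  using assms
  by (simp_all add: A2_def A3_def A4_def blinfun.scaleR_right blinfun.scaleR_left scaleR_conv_of_real
      power_mult_distrib eval_nat_numeral mult.assoc[symmetric] del: fact_Suc)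

text \<open>Comparing coefficients in \<open>p h = h + \<zeta> h'\<close>: the mixed terms cancel.\<close>

lemma logarithmic_derivative_coefficients:
  fixes h p :: "complex \<Rightarrow> complex"
  assumes h: "h holomorphic_on ball 0 1" and p: "p holomorphic_on ball 0 1"
    and h0: "h 0 = 1" and ph: "\<And>\<zeta>. \<zeta> \<in> ball 0 1 \<Longrightarrow> p \<zeta> * h \<zeta> = h \<zeta> + \<zeta> * deriv h \<zeta>"
  defines "H \<equiv> fps_nth (fps_expansion h 0)" and "P \<equiv> fps_nth (fps_expansion p 0)"
  shows "H 1 * H 2 - H 3 = (P 1 ^ 3 - P 3) / 3"
proof -
  have eh: "h has_fps_expansion fps_expansion h 0" and ep: "p has_fps_expansion fps_expansion p 0"
    using has_fps_expansion_fps_expansion[OF open_ball _ h] has_fps_expansion_fps_expansion[OF open_ball _ p]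
    by auto
  have "eventually (\<lambda>\<zeta>. p \<zeta> * h \<zeta> = h \<zeta> + \<zeta> * deriv h \<zeta>) (nhds 0)"
    using ph eventually_nhds_in_open[OF open_ball, of "0::complex" 0 1]
    by (auto elim: eventually_mono)
  then have "(\<lambda>\<zeta>. p \<zeta> * h \<zeta>) has_fps_expansion
      (fps_expansion h 0 + fps_X * fps_deriv (fps_expansion h 0))"
    by (subst has_fps_expansion_cong[OF _ refl]) (assumption, intro fps_expansion_intros eh)
  then have eq: "fps_expansion p 0 * fps_expansion h 0
      = fps_expansion h 0 + fps_X * fps_deriv (fps_expansion h 0)"
    using has_fps_expansion_mult[OF ep eh] fps_expansion_eqI by metis
  have H0: "H 0 = 1" using h0 by (simp add: H_def fps_expansion_def)
  have c: "(\<Sum>i\<le>n. P i * H (n - i)) = H n + of_nat n * H n" for n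
    using arg_cong[OF eq, of "\<lambda>F. fps_nth F n"]
    by (cases n) (simp_all add: fps_mult_nth[of "fps_expansion p 0"] P_def H_def atLeast0AtMost fps_X_mult_nth)
  have P0: "P 0 = 1" using c[of 0] H0 by simp
  have 1: "P 1 = H 1" using c[of 1] H0 P0 by simp
  have 2: "P 2 + P 1 * H 1 = 2 * H 2"
    using c[of 2] H0 P0 by (simp add: numeral_2_eq_2 algebra_simps)
  have 3: "P 3 + P 2 * H 1 + P 1 * H 2 = 3 * H 3"
    using c[of 3] H0 P0 by (simp add: numeral_3_eq_3 numeral_2_eq_2 algebra_simps)
  have "P 1 * (P 2 + P 1 * P 1) = P 1 * (2 * H 2)"
    using 1 2 by simp
  moreover have "3 * H 3 = P 3 + P 2 * P 1 + P 1 * H 2"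
    using 1 3 by simp
  ultimately have "3 * (H 1 * H 2 - H 3) = P 1 ^ 3 - P 3"
    unfolding 1[symmetric] by (simp add: power3_eq_cube algebra_simps)
  then show ?thesis by (simp add: field_simps)
qed

section \<open>Functions with positive real part\<close>

locale caratheodory =
  fixes q :: "complex \<Rightarrow> complex"
  assumes holomorphic: "q holomorphic_on ball 0 1"
    and zero: "q 0 = 1"
    and Re_nonneg: "\<And>\<zeta>. \<zeta> \<in> ball 0 1 \<Longrightarrow> 0 \<le> Re (q \<zeta>)"
begin

definition coeff :: "nat \<Rightarrow> complex"
  where "coeff n = fps_nth (fps_expansion q 0) n"

text \<open>
  On the circle of radius \<open>r\<close> the trigonometric polynomial is the restriction of a Laurent
  polynomial \<open>T\<close>, and Cauchy's formula evaluates the mean of \<open>q T\<close>, whose real part is nonnegative.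
\<close>

lemma trigonometric_test_radius:
  fixes a b c r :: real
  assumes T: "\<And>t. 0 \<le> a + b * cos t + c * cos (3 * t)" and r: "0 < r" "r < 1"
  shows "0 \<le> a + b * (r * Re (coeff 1)) / 2 + c * (r ^ 3 * Re (coeff 3)) / 2"
proof -
  have r0: "complex_of_real r \<noteq> 0" using r by simp
  have sub: "cball 0 r \<subseteq> ball (0::complex) 1" using r by auto
  have int: "((\<lambda>u. q u / u ^ Suc k) has_contour_integral 2 * pi * \<i> * coeff k) (circlepath 0 r)" for k
    using Cauchy_has_contour_integral_higher_derivative_circlepath[of 0 r q 0 k]
      holomorphic_on_subset[OF holomorphic sub] holomorphic_on_subset[OF holomorphic order_trans[OF ball_subset_cball sub]] r
    by (simp add: holomorphic_on_imp_continuous_on coeff_def fps_expansion_def)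
  have int0: "((\<lambda>u. q u * u ^ k) has_contour_integral 0) (circlepath 0 r)" for k
    by (rule Cauchy_theorem_convex_simple[of _ "ball 0 1"])
       (use r sub in \<open>auto intro!: holomorphic_intros holomorphic\<close>)
  have c0: "coeff 0 = 1" by (simp add: coeff_def fps_expansion_def zero)
  define W where "W u = (of_real a * (q u / u ^ Suc 0)
      + (of_real (b / (2 * r)) * (q u * u ^ 0) + of_real (b * r / 2) * (q u / u ^ Suc 1)))
      + (of_real (c / (2 * r ^ 3)) * (q u * u ^ 2) + of_real (c * r ^ 3 / 2) * (q u / u ^ Suc 3))" for u
  define V where "V = of_real a + of_real (b * r / 2) * coeff 1 + of_real (c * r ^ 3 / 2) * coeff 3"
  have "(W has_contour_integral (of_real a * (2 * pi * \<i> * coeff 0)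
      + (of_real (b / (2 * r)) * 0 + of_real (b * r / 2) * (2 * pi * \<i> * coeff 1)))
      + (of_real (c / (2 * r ^ 3)) * 0 + of_real (c * r ^ 3 / 2) * (2 * pi * \<i> * coeff 3))) (circlepath 0 r)"
    unfolding W_def by (intro has_contour_integral_add has_contour_integral_lmul int int0)
  also have "(of_real a * (2 * pi * \<i> * coeff 0)
      + (of_real (b / (2 * r)) * 0 + of_real (b * r / 2) * (2 * pi * \<i> * coeff 1)))
      + (of_real (c / (2 * r ^ 3)) * 0 + of_real (c * r ^ 3 / 2) * (2 * pi * \<i> * coeff 3)) = 2 * pi * \<i> * V"
    by (simp add: V_def c0 algebra_simps)
  finally have "((\<lambda>t. W (0 + of_real r * cis t) * of_real r * \<i> * cis t) has_integral 2 * pi * \<i> * V) {0..2*pi}"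
    unfolding circlepath_def by (subst (asm) has_contour_integral_part_circlepath_iff) auto
  moreover have "W (0 + of_real r * cis t) * of_real r * \<i> * cis t
      = \<i> * (q (of_real r * cis t) * of_real (a + b * cos t + c * cos (3 * t)))" for t
  proof -
    define w where "w = cis t"
    have w0: "w \<noteq> 0" by (simp add: w_def)
    have "of_real (cos t) = (w + 1 / w) / 2"
      by (simp add: w_def complex_eq_iff inverse_eq_divide[symmetric])
    moreover have "of_real (cos (3 * t)) = (w ^ 3 + 1 / w ^ 3) / 2"
    proof -
      have "w ^ 3 = cis (3 * t)" by (simp add: w_def Complex.DeMoivre)
      then show ?thesis by (simp add: complex_eq_iff inverse_eq_divide[symmetric])
    qed
    ultimately have T: "of_real (a + b * cos t + c * cos (3 * t))
        = of_real a + of_real b * (w + 1 / w) / 2 + of_real c * (w ^ 3 + 1 / w ^ 3) / 2"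
      by (simp only: of_real_add of_real_mult times_divide_eq_right)
    show ?thesis
      unfolding W_def w_def[symmetric] T using r0 w0
      by (simp add: field_simps eval_nat_numeral)
  qed
  ultimately have I: "((\<lambda>t. \<i> * (q (of_real r * cis t) * of_real (a + b * cos t + c * cos (3 * t))))
      has_integral 2 * pi * \<i> * V) {0..2*pi}"
    by (simp only:)
  have "((\<lambda>t. Re (q (of_real r * cis t)) * (a + b * cos t + c * cos (3 * t))) has_integral 2 * pi * Re V) {0..2*pi}"
    using has_integral_linear[OF I bounded_linear_Im] by (simp add: o_def)
  then have "0 \<le> 2 * pi * Re V"
    by (rule has_integral_nonneg) (use r in \<open>auto intro!: mult_nonneg_nonneg Re_nonneg T simp: norm_mult\<close>)
  then have "0 \<le> Re V" using pi_gt_zero by (auto simp: zero_le_mult_iff)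
  then show ?thesis by (simp add: V_def)
qed

lemma trigonometric_test:
  fixes a b c :: real
  assumes T: "\<And>t. 0 \<le> a + b * cos t + c * cos (3 * t)"
  shows "0 \<le> a + b * Re (coeff 1) / 2 + c * Re (coeff 3) / 2"
proof (rule tendsto_lowerbound)
  show "((\<lambda>r. a + b * (r * Re (coeff 1)) / 2 + c * (r ^ 3 * Re (coeff 3)) / 2)
      \<longlongrightarrow> a + b * Re (coeff 1) / 2 + c * Re (coeff 3) / 2) (at_left 1)"
    by (auto intro!: tendsto_eq_intros)
  have "eventually (\<lambda>r::real. r \<in> {0<..<1}) (at_left 1)"
    by (rule eventually_at_leftI[of 0]) auto
  then show "\<forall>\<^sub>F r in at_left 1. 0 \<le> a + b * (r * Re (coeff 1)) / 2 + c * (r ^ 3 * Re (coeff 3)) / 2"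
    by eventually_elim (intro trigonometric_test_radius T, auto)
qed simp

end

lemma caratheodory_rotate:
  assumes "caratheodory q" and c: "cmod c = 1"
  shows "caratheodory (\<lambda>\<zeta>. q (c * \<zeta>))"
    and "caratheodory.coeff (\<lambda>\<zeta>. q (c * \<zeta>)) n = c ^ n * caratheodory.coeff q n"
proof -
  interpret caratheodory q by fact
  have ball: "c * \<zeta> \<in> ball 0 1" if "\<zeta> \<in> ball 0 1" for \<zeta>
    using that c by (simp add: norm_mult)
  show rot: "caratheodory (\<lambda>\<zeta>. q (c * \<zeta>))"
  proof
    have "q \<circ> (\<lambda>\<zeta>. c * \<zeta>) holomorphic_on ball 0 1"
      by (rule holomorphic_on_compose_gen[OF _ holomorphic]) (use ball in \<open>auto intro!: holomorphic_intros\<close>)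
    then show "(\<lambda>\<zeta>. q (c * \<zeta>)) holomorphic_on ball 0 1" by (simp add: o_def)
  qed (use zero Re_nonneg ball in auto)
  have "(deriv ^^ n) (\<lambda>\<zeta>. q (c * \<zeta>)) 0 = c ^ n * (deriv ^^ n) q (c * 0)"
    by (rule higher_deriv_compose_linear[OF holomorphic open_ball[of 0 1] open_ball]) (use ball in auto)
  then show "caratheodory.coeff (\<lambda>\<zeta>. q (c * \<zeta>)) n = c ^ n * coeff n"
    by (simp add: caratheodory.coeff_def[OF rot] coeff_def fps_expansion_def)
qed

text \<open>
  Of the three cube roots of a unit number, which add up to zero, one turns a given number into
  the right half plane.
\<close>

lemma cube_root_into_half_plane:
  fixes m v :: complex
  obtains c where "cmod c = 1" "c ^ 3 * v = - of_real (cmod v)" "0 \<le> Re (c * m)"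
proof -
  define \<theta> where "\<theta> = (if v = 0 then 0 else (pi - Arg v) / 3)"
  define \<omega> where "\<omega> = cis (2 * pi / 3)"
  have \<omega>3: "\<omega> ^ 3 = 1" by (simp add: \<omega>_def Complex.DeMoivre)
  have "\<omega> \<noteq> 1"
    using cos_120 by (auto simp: \<omega>_def complex_eq_iff)
  moreover have "(\<omega> - 1) * (1 + \<omega> + \<omega> ^ 2) = 0"
    using \<omega>3 by algebra
  ultimately have "1 + \<omega> + \<omega> ^ 2 = 0" by simp
  then have "Re ((1 + \<omega> + \<omega> ^ 2) * (cis \<theta> * m)) = 0"
    by simp
  then have "Re (cis \<theta> * m) + Re (\<omega> * (cis \<theta> * m)) + Re (\<omega> ^ 2 * (cis \<theta> * m)) = 0"
    by (simp only: distrib_right mult_1 plus_complex.sel)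
  then obtain k :: nat where k: "0 \<le> Re (\<omega> ^ k * (cis \<theta> * m))"
    by (metis add_neg_neg less_irrefl mult_1 not_le power_0 power_one_right)
  have c3: "cis \<theta> ^ 3 * v = - of_real (cmod v)"
  proof (cases "v = 0")
    case False
    have "cis (pi - Arg v) * v = cis (pi - Arg v) * (of_real (cmod v) * cis (Arg v))"
      using rcis_cmod_Arg[of v] by (simp add: rcis_def)
    also have "\<dots> = of_real (cmod v) * (cis (pi - Arg v) * cis (Arg v))" by simp
    also have "\<dots> = - of_real (cmod v)" by (simp only: cis_mult) simp
    also have "pi - Arg v = 3 * \<theta>" using False by (simp add: \<theta>_def)
    finally show ?thesis by (simp add: Complex.DeMoivre)
  qed simp
  show ?thesis
  proof (rule that)
    show "cmod (\<omega> ^ k * cis \<theta>) = 1" by (simp add: \<omega>_def norm_mult norm_power)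
    have "(\<omega> ^ k) ^ 3 = 1" using \<omega>3 by (metis power_mult mult.commute power_one)
    then show "(\<omega> ^ k * cis \<theta>) ^ 3 * v = - of_real (cmod v)"
      using c3 by (simp add: power_mult_distrib)
    show "0 \<le> Re (\<omega> ^ k * cis \<theta> * m)" using k by (simp add: mult.assoc)
  qed
qed

text \<open>
  Means are taken with respect to the measure representing the rotated function.
  After a rotation the modulus becomes \<open>4 s Re M\<^sup>3 - Re E\<close> with \<open>Re M \<ge> 0\<close>, and
  \<open>Re M\<^sup>3 \<le> (Re M)\<^sup>3\<close>.  What remains is an upper bound for \<open>- Re E\<close>, the mean of \<open>- cos 3t\<close>, in
  terms of \<open>X = Re M\<close>, the mean of \<open>cos t\<close>: it is \<open>1\<close>, or the tangent at \<open>X\<close> to the concave part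
  \<open>x \<ge> 0\<close> of \<open>- cos 3t = 3 x - 4 x\<^sup>3\<close>, \<open>x = cos t\<close>, which lies above the whole graph
  once \<open>X \<ge> 1/2\<close>.
\<close>

lemma caratheodory_third_coefficient_bound:
  fixes s K :: real
  assumes q: "caratheodory q" and s: "0 \<le> s"
    and K1: "1 + s / 2 \<le> K"
    and K2: "\<And>X. 1 / 2 \<le> X \<Longrightarrow> X \<le> 1 \<Longrightarrow> 3 * X - 4 * (1 - s) * X ^ 3 \<le> K"
  shows "cmod (caratheodory.coeff q 3 / 2 - 4 * of_real s * (caratheodory.coeff q 1 / 2) ^ 3) \<le> K"
proof -
  define m where "m = caratheodory.coeff q 1 / 2"
  define e where "e = caratheodory.coeff q 3 / 2"
  define v where "v = e - 4 * of_real s * m ^ 3"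
  obtain c where c: "cmod c = 1" "c ^ 3 * v = - of_real (cmod v)" "0 \<le> Re (c * m)"
    using cube_root_into_half_plane by blast
  define M where "M = c * m"
  define E where "E = c ^ 3 * e"
  define X where "X = Re M"
  have test: "0 \<le> a + b * X + d * Re E" if "\<And>t. 0 \<le> a + b * cos t + d * cos (3 * t)" for a b d
    using caratheodory.trigonometric_test[OF caratheodory_rotate(1)[OF q c(1)] that]
    by (simp add: caratheodory_rotate(2)[OF q c(1)] M_def E_def X_def m_def e_def)
  have X0: "0 \<le> X" using c(3) by (simp add: X_def M_def)
  have X1: "X \<le> 1" using test[of 1 "-1" 0] by simp
  have "- of_real (cmod v) = E - 4 * of_real s * M ^ 3"
    using c(2) by (simp add: v_def E_def M_def power_mult_distrib algebra_simps)
  then have "cmod v = Re (4 * of_real s * M ^ 3 - E)"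
    by (simp add: complex_eq_iff)
  also have "\<dots> = 4 * s * (X ^ 3 - 3 * X * (Im M)\<^sup>2) - Re E"
    by (simp add: X_def power3_eq_cube power2_eq_square algebra_simps)
  also have "\<dots> \<le> 4 * s * X ^ 3 - Re E"
    using s X0 by (simp add: mult_left_mono)
  also have "\<dots> \<le> K"
  proof (cases "X \<le> 1 / 2")
    case True
    have "0 \<le> 1 + Re E"
    proof -
      have "0 \<le> 1 + 0 * cos t + 1 * cos (3 * t)" for t :: real
        using cos_ge_minus_one[of "3 * t"] by linarith
      from test[OF this] show ?thesis by simp
    qed
    moreover have "X ^ 3 \<le> (1 / 2) ^ 3" using True X0 by (rule power_mono)
    then have "4 * s * X ^ 3 \<le> 4 * s * (1 / 2) ^ 3" using s by (intro mult_left_mono) auto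
    ultimately show ?thesis using K1 by (simp add: power3_eq_cube)
  next
    case False
    have "0 \<le> 8 * X ^ 3 + (- (12 * X\<^sup>2 - 3)) * cos t + 1 * cos (3 * t)" for t
    proof -
      have "0 \<le> 4 * (cos t - X)\<^sup>2 * (cos t + 2 * X)"
      proof (intro mult_nonneg_nonneg)
        show "0 \<le> cos t + 2 * X" using False cos_ge_minus_one[of t] by linarith
      qed auto
      also have "\<dots> = 8 * X ^ 3 + (- (12 * X\<^sup>2 - 3)) * cos t + 1 * cos (3 * t)"
        unfolding cos_treble_cos by algebra
      finally show ?thesis .
    qed
    from test[OF this] have "- Re E \<le> 3 * X - 4 * X ^ 3"
      by (simp add: power3_eq_cube power2_eq_square algebra_simps)
    then show ?thesis
      using K2[of X] False X1 by (simp add: algebra_simps)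
  qed
  finally show ?thesis by (simp add: v_def e_def m_def)
qed

lemma caratheodory_third_coefficient_bound_small:
  fixes s :: real
  assumes q: "caratheodory q" and s: "0 \<le> s" "s \<le> 3 / 4"
  shows "cmod (caratheodory.coeff q 3 / 2 - 4 * of_real s * (caratheodory.coeff q 1 / 2) ^ 3)
    \<le> 1 / sqrt (1 - s)"
proof (rule caratheodory_third_coefficient_bound[OF q s(1)])
  define \<kappa> where "\<kappa> = sqrt (1 - s)"
  have \<kappa>: "\<kappa> > 0" "\<kappa>\<^sup>2 = 1 - s" using s by (auto simp: \<kappa>_def)
  have "((1 + s / 2) * \<kappa>)\<^sup>2 = 1 - s\<^sup>2 * (3 + s) / 4"
    unfolding power_mult_distrib \<kappa>(2) by (simp add: field_simps power2_eq_square)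
  also have "\<dots> \<le> 1\<^sup>2" using s by simp
  finally have "(1 + s / 2) * \<kappa> \<le> 1" by (rule power2_le_imp_le) simp
  then show "1 + s / 2 \<le> 1 / sqrt (1 - s)"
    using \<kappa>(1) by (simp add: \<kappa>_def[symmetric] field_simps)
  show "3 * X - 4 * (1 - s) * X ^ 3 \<le> 1 / sqrt (1 - s)" if X: "1 / 2 \<le> X" for X
  proof -
    have "0 \<le> (1 + \<kappa> * X) * (2 * (\<kappa> * X) - 1)\<^sup>2" using \<kappa>(1) X by simp
    also have "\<dots> = 1 - \<kappa> * (3 * X - 4 * \<kappa>\<^sup>2 * X ^ 3)" by algebra
    finally show ?thesis
      using \<kappa>(1) unfolding \<kappa>(2) by (simp add: \<kappa>_def[symmetric] field_simps)
  qed
qed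

lemma caratheodory_third_coefficient_bound_large:
  fixes s :: real
  assumes q: "caratheodory q" and s: "3 / 4 \<le> s" "s \<le> 1"
  shows "cmod (caratheodory.coeff q 3 / 2 - 4 * of_real s * (caratheodory.coeff q 1 / 2) ^ 3)
    \<le> 4 * s - 1"
proof (rule caratheodory_third_coefficient_bound[OF q])
  show "3 * X - 4 * (1 - s) * X ^ 3 \<le> 4 * s - 1" if X: "1 / 2 \<le> X" "X \<le> 1" for X
  proof -
    have "X ^ 2 \<le> 1" using X by (simp add: power_le_one)
    then have "(1 - s) * (X\<^sup>2 + X + 1) \<le> (1 / 4) * 3"
      using X s by (intro mult_mono) auto
    then have "0 \<le> (1 - X) * (3 - 4 * ((1 - s) * (X\<^sup>2 + X + 1)))"
      using X by (intro mult_nonneg_nonneg) auto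
    also have "\<dots> = 4 * s - 1 - (3 * X - 4 * (1 - s) * X ^ 3)" by algebra
    finally show ?thesis by simp
  qed
qed (use s in auto)

section \<open>Starlikeness of scalar multiples of the identity\<close>

lemma scalar_multiple_has_derivative:
  assumes f: "f fholomorphic_on ball 0 1"
    and F: "\<And>z. z \<in> ball 0 1 \<Longrightarrow> F z = f z *\<^sub>C (z::'a::complex_normed_vector)"
    and z: "z \<in> ball 0 1"
  shows "(F has_derivative (\<lambda>w. f z *\<^sub>C w + blinfun_apply (fderiv f z) w *\<^sub>C z)) (at z)"
proof -
  have "((\<lambda>z. f z *\<^sub>C z) has_derivative (\<lambda>w. f z *\<^sub>C w + blinfun_apply (fderiv f z) w *\<^sub>C z)) (at z)"
    by (rule bounded_bilinear.FDERIV[OF bounded_bilinear_scaleC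
          fholomorphic_on_has_derivative[OF f z] has_derivative_ident])
  then show ?thesis
    by (rule has_derivative_transform_within_open[OF _ open_ball z]) (simp add: F)
qed

lemma fderiv_scalar_multiple:
  assumes f: "f fholomorphic_on ball 0 1"
    and F: "\<And>z. z \<in> ball 0 1 \<Longrightarrow> F z = f z *\<^sub>C (z::'a::complex_normed_vector)"
    and z: "z \<in> ball 0 1"
  shows "blinfun_apply (fderiv F z) w = f z *\<^sub>C w + blinfun_apply (fderiv f z) w *\<^sub>C z"
  using fderiv_eq[of F "Blinfun (\<lambda>w. f z *\<^sub>C w + blinfun_apply (fderiv f z) w *\<^sub>C z)" z]
    scalar_multiple_has_derivative[OF assms]
  by (simp add: bounded_linear_Blinfun_apply has_derivative_bounded_linear)

lemma fholomorphic_scalar_multiple: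
  assumes f: "f fholomorphic_on ball 0 1"
    and F: "\<And>z. z \<in> ball 0 1 \<Longrightarrow> F z = f z *\<^sub>C (z::'a::complex_normed_vector)"
  shows "F fholomorphic_on ball 0 1"
  unfolding fholomorphic_on_def
proof (intro ballI exI conjI)
  fix z :: 'a assume z: "z \<in> ball 0 1"
  have D: "blinfun_apply (fderiv F z) = (\<lambda>w. f z *\<^sub>C w + blinfun_apply (fderiv f z) w *\<^sub>C z)"
    by (rule ext) (rule fderiv_scalar_multiple[OF f F z])
  show "(F has_derivative blinfun_apply (fderiv F z)) (at z)"
    using scalar_multiple_has_derivative[OF f F z] by (simp add: D)
  show "complex_linear (fderiv F z)"
    unfolding complex_linear_def D
    by (simp add: complex_linearD[OF fholomorphic_on_complex_linear[OF f z]] scaleC_complex_def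
        scaleC_add_right scaleC_scaleC mult.commute)
qed

text \<open>The disc in the definition of starlikeness is the image of a half plane under inversion.\<close>

lemma disc_iff_Re_inverse:
  fixes c :: complex
  assumes "\<alpha> > 0" "c \<noteq> 0"
  shows "cmod (c - of_real (1 / (2 * \<alpha>))) < 1 / (2 * \<alpha>) \<longleftrightarrow> \<alpha> < Re (1 / c)"
proof -
  have c: "0 < (cmod c)\<^sup>2" using assms by simp
  define x where "x = 1 / (2 * \<alpha>)"
  have x: "x > 0" "Re c / \<alpha> = 2 * x * Re c" using assms by (auto simp: x_def)
  have "(cmod (c - of_real x))\<^sup>2 = (cmod c)\<^sup>2 - 2 * x * Re c + x\<^sup>2"
    unfolding cmod_power2 by (simp add: power2_eq_square algebra_simps)
  moreover have "cmod (c - of_real x) < x \<longleftrightarrow> (cmod (c - of_real x))\<^sup>2 < x\<^sup>2"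
    using x(1) power_mono_iff[of x "cmod (c - of_real x)" 2] by (simp add: not_le[symmetric])
  ultimately have "cmod (c - of_real (1 / (2 * \<alpha>))) < 1 / (2 * \<alpha>) \<longleftrightarrow> (cmod c)\<^sup>2 < Re c / \<alpha>"
    unfolding x(2) x_def[symmetric] by auto
  also have "\<dots> \<longleftrightarrow> \<alpha> < Re c / (cmod c)\<^sup>2"
    using assms c by (simp add: pos_less_divide_eq mult.commute)
  also have "Re c / (cmod c)\<^sup>2 = Re (1 / c)"
    by (simp add: Re_divide cmod_power2)
  finally show ?thesis .
qed

lemma support_functionals_rotate:
  assumes l: "l \<in> support_functionals e" and e: "norm e = 1" and \<zeta>: "\<zeta> \<noteq> 0"
  shows "(cnj \<zeta> / cmod \<zeta>) *\<^sub>C l \<in> support_functionals (\<zeta> *\<^sub>C e)"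
proof -
  have "complex_linear l" "blinfun_apply l e = 1" "norm l = 1"
    using l e by (auto simp: support_functionals_def)
  then show ?thesis
    using \<zeta> e complex_norm_square[of \<zeta>]
    by (simp add: support_functionals_def complex_linear_def scaleC_blinfun.rep_eq norm_scaleC
        scaleC_complex_def norm_divide field_simps power2_eq_square)
qed

text \<open>
  The derivative of \<open>z \<mapsto> f(z) z\<close> maps the line through \<open>z\<close> to itself, with multiplier
  \<open>f(z) + Df(z) z\<close>, so that the preimage of \<open>F(z)\<close> is a multiple of \<open>z\<close> and the starlikeness
  condition at \<open>\<zeta> e\<close> concerns the logarithmic derivative of the restriction of \<open>f\<close> to \<open>\<complex> e\<close>.
\<close>

lemma starlike_slice:
  fixes f :: "'a::complex_banach \<Rightarrow> complex"
  assumes F: "starlike_scalar_multiple \<alpha> f F" and \<alpha>: "0 < \<alpha>" "\<alpha> < 1"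
    and l: "l \<in> support_functionals e" and e: "norm e = 1" and \<zeta>: "\<zeta> \<in> ball 0 1"
  defines "h \<equiv> \<lambda>\<zeta>. f (\<zeta> *\<^sub>C e)"
  shows "h \<zeta> \<noteq> 0 \<and> \<alpha> < Re ((h \<zeta> + \<zeta> * deriv h \<zeta>) / h \<zeta>)"
proof (cases "\<zeta> = 0")
  case True
  then show ?thesis using F \<alpha> by (simp add: h_def starlike_scalar_multiple_def)
next
  case False
  have f: "f fholomorphic_on ball 0 1" and Ff: "\<And>z. z \<in> ball 0 1 \<Longrightarrow> F z = f z *\<^sub>C z"
    and FS: "F \<in> starlike_of_order \<alpha>"
    using F by (auto simp: starlike_scalar_multiple_def)
  define z where "z = \<zeta> *\<^sub>C e"
  have nz: "norm z = cmod \<zeta>" using e by (simp add: z_def norm_scaleC)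
  then have z: "z \<in> ball 0 1" and z0: "z \<noteq> 0" using \<zeta> False by auto
  define l' where "l' = (cnj \<zeta> / cmod \<zeta>) *\<^sub>C l"
  have l': "l' \<in> support_functionals z"
    unfolding l'_def z_def by (rule support_functionals_rotate[OF l e False])
  then have l'z: "complex_linear l'" "blinfun_apply l' z = of_real (norm z)"
    by (auto simp: support_functionals_def)
  define w where "w = inv (blinfun_apply (fderiv F z)) (F z)"
  have bij: "bij (blinfun_apply (fderiv F z))"
    and disc: "cmod (complex_of_real (1 / norm z) * blinfun_apply l' w - complex_of_real (1 / (2 * \<alpha>)))
      < 1 / (2 * \<alpha>)"
    using FS z z0 l' by (auto simp: starlike_of_order_def locally_biholomorphic_def w_def)
  define a where "a = f z"
  define L where "L = fderiv f z"
  have Llin: "blinfun_apply L (c *\<^sub>C v) = c * blinfun_apply L v" for c v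
    unfolding L_def
    using complex_linearD[OF fholomorphic_on_complex_linear[OF f z]] by (simp add: scaleC_complex_def)
  have "blinfun_apply (fderiv F z) w = F z"
    unfolding w_def using bij by (simp add: bij_is_surj surj_f_inv_f)
  moreover have "blinfun_apply (fderiv F z) w = f z *\<^sub>C w + blinfun_apply (fderiv f z) w *\<^sub>C z"
    by (rule fderiv_scalar_multiple[OF f Ff z])
  ultimately have w: "a *\<^sub>C w + blinfun_apply L w *\<^sub>C z = a *\<^sub>C z"
    by (simp add: Ff[OF z] a_def L_def)
  have a: "a \<noteq> 0"
  proof
    assume "a = 0"
    then have "w = inv (blinfun_apply (fderiv F z)) (blinfun_apply (fderiv F z) 0)"
      using Ff[OF z] by (simp add: w_def a_def)
    then have "w = 0" using bij by (simp add: bij_is_inj inv_f_f del: blinfun.zero_right)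
    with disc \<alpha> show False by (simp add: norm_divide)
  qed
  define c where "c = (a - blinfun_apply L w) / a"
  have "a *\<^sub>C w = (a - blinfun_apply L w) *\<^sub>C z"
    using w by (simp add: scaleC_diff_left algebra_simps)
  then have "(1 / a) *\<^sub>C a *\<^sub>C w = (1 / a) *\<^sub>C (a - blinfun_apply L w) *\<^sub>C z" by simp
  then have wc: "w = c *\<^sub>C z" using a by (simp add: scaleC_scaleC c_def)
  have "(c * (a + blinfun_apply L z) - a) *\<^sub>C z = 0"
    using w unfolding wc
    by (simp add: Llin scaleC_scaleC scaleC_diff_left scaleC_add_left algebra_simps)
  then have "cmod (c * (a + blinfun_apply L z) - a) * norm z = 0"
    by (metis norm_scaleC norm_zero)
  then have ca: "c * (a + blinfun_apply L z) = a" using z0 by simp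
  then have c0: "c \<noteq> 0" using a by auto
  have "complex_of_real (1 / norm z) * blinfun_apply l' w = c"
    using z0 by (simp add: wc complex_linearD[OF l'z(1)] l'z(2) scaleC_complex_def)
  then have "\<alpha> < Re (1 / c)"
    using disc disc_iff_Re_inverse[OF \<alpha>(1) c0] by simp
  also have "1 / c = (a + blinfun_apply L z) / a"
    using ca c0 a by (simp add: field_simps)
  also have "\<dots> = (h \<zeta> + \<zeta> * deriv h \<zeta>) / h \<zeta>"
    using fholomorphic_slice_holomorphic(2)[OF f e \<zeta>]
    by (simp add: h_def a_def L_def z_def complex_linearD[OF fholomorphic_on_complex_linear[OF f z[unfolded z_def]]] scaleC_complex_def)
  finally show ?thesis using a by (simp add: h_def a_def z_def)
qed

lemma order_coefficients:
  fixes h q :: "complex \<Rightarrow> complex"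
  assumes h: "h holomorphic_on ball 0 1" "h 0 = 1" and q: "caratheodory q"
    and qh: "\<And>\<zeta>. \<zeta> \<in> ball 0 1 \<Longrightarrow> (of_real \<alpha> + of_real (1 - \<alpha>) * q \<zeta>) * h \<zeta> = h \<zeta> + \<zeta> * deriv h \<zeta>"
  defines "H \<equiv> fps_nth (fps_expansion h 0)"
  shows "H 1 * H 2 - H 3 =
    (of_real ((1 - \<alpha>) ^ 3) * caratheodory.coeff q 1 ^ 3 - of_real (1 - \<alpha>) * caratheodory.coeff q 3) / 3"
proof -
  interpret caratheodory q by fact
  define p where "p \<zeta> = of_real \<alpha> + of_real (1 - \<alpha>) * q \<zeta>" for \<zeta>
  have "q has_fps_expansion fps_expansion q 0"
    by (rule has_fps_expansion_fps_expansion[OF open_ball _ holomorphic]) simp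
  then have "p has_fps_expansion fps_const (of_real \<alpha>) + fps_const (of_real (1 - \<alpha>)) * fps_expansion q 0"
    unfolding p_def by (intro fps_expansion_intros)
  then have P: "fps_nth (fps_expansion p 0) n = of_real (1 - \<alpha>) * coeff n" if "n > 0" for n
    using that by (simp add: fps_expansion_eqI coeff_def)
  have "p holomorphic_on ball 0 1"
    unfolding p_def by (intro holomorphic_intros holomorphic)
  moreover have "p \<zeta> * h \<zeta> = h \<zeta> + \<zeta> * deriv h \<zeta>" if "\<zeta> \<in> ball 0 1" for \<zeta>
    unfolding p_def by (rule qh[OF that])
  ultimately have "H 1 * H 2 - H 3 = (fps_nth (fps_expansion p 0) 1 ^ 3 - fps_nth (fps_expansion p 0) 3) / 3"
    unfolding H_def by (intro logarithmic_derivative_coefficients h)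
  then show ?thesis by (simp add: P power_mult_distrib)
qed

text \<open>
  For \<open>q = (p - \<alpha>) / (1 - \<alpha>)\<close> and \<open>\<beta> = 1 - \<alpha>\<close> the functional is \<open>2 \<beta> / 3\<close> times the one
  bounded for functions with positive real part, with \<open>s = \<beta>\<^sup>2\<close>.
\<close>

lemma starlike_caratheodory:
  fixes f :: "'a::complex_banach \<Rightarrow> complex"
  assumes F: "starlike_scalar_multiple \<alpha> f F" and \<alpha>: "0 < \<alpha>" "\<alpha> < 1"
    and l: "l \<in> support_functionals z" and z: "z \<noteq> 0"
  obtains q where "caratheodory q"
    "cmod (A2 F l z * A3 F l z - A4 F l z) = 2 * (1 - \<alpha>) / 3 *
      cmod (caratheodory.coeff q 3 / 2 - 4 * of_real ((1 - \<alpha>)\<^sup>2) * (caratheodory.coeff q 1 / 2) ^ 3)"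
proof -
  define e where "e = (1 / norm z) *\<^sub>R z"
  have e: "norm e = 1" and ze: "z = norm z *\<^sub>R e" using z by (auto simp: e_def)
  have le: "l \<in> support_functionals e"
    using l z by (simp add: e_def support_functionals_scaleR)
  have f: "f fholomorphic_on ball 0 1" and Ff: "\<And>z. z \<in> ball 0 1 \<Longrightarrow> F z = f z *\<^sub>C z" and f0: "f 0 = 1"
    and FS: "F fholomorphic_on ball 0 1"
    using F by (auto simp: starlike_scalar_multiple_def starlike_of_order_def)
  define h where "h = (\<lambda>\<zeta>. f (\<zeta> *\<^sub>C e))"
  have h: "h holomorphic_on ball 0 1" "h 0 = 1"
    using fholomorphic_slice_holomorphic(1)[OF f e] f0 by (auto simp: h_def)
  have st: "h \<zeta> \<noteq> 0" "\<alpha> < Re ((h \<zeta> + \<zeta> * deriv h \<zeta>) / h \<zeta>)" if "\<zeta> \<in> ball 0 1" for \<zeta>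
    using starlike_slice[OF F \<alpha> le e that] by (simp_all add: h_def)
  define q where "q \<zeta> = ((h \<zeta> + \<zeta> * deriv h \<zeta>) / h \<zeta> - of_real \<alpha>) / of_real (1 - \<alpha>)" for \<zeta>
  have \<beta>: "complex_of_real (1 - \<alpha>) \<noteq> 0" using \<alpha> by simp
  have q: "caratheodory q"
  proof
    show "q holomorphic_on ball 0 1"
      unfolding q_def using st(1) \<beta> h(1) by (intro holomorphic_intros) auto
    show "q 0 = 1" using h(2) \<beta> by (simp add: q_def)
    show "0 \<le> Re (q \<zeta>)" if "\<zeta> \<in> ball 0 1" for \<zeta>
      using st(2)[OF that] \<alpha> unfolding q_def Re_divide_of_real by simp
  qed
  have "(of_real \<alpha> + of_real (1 - \<alpha>) * q \<zeta>) * h \<zeta> = h \<zeta> + \<zeta> * deriv h \<zeta>" if "\<zeta> \<in> ball 0 1" for \<zeta>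
    using st(1)[OF that] \<beta> unfolding q_def by simp
  note co = order_coefficients[OF h q this]
  define c1 where "c1 = caratheodory.coeff q 1"
  define c3 where "c3 = caratheodory.coeff q 3"
  have "A2 F l z = A2 F l e" "A3 F l z = A3 F l e" "A4 F l z = A4 F l e"
    using A_scaleR[where F = F and l = l and z = e and r = "norm z"] z by (simp_all flip: ze)
  moreover have "A2 F l e = fps_nth (fps_expansion h 0) 1" "A3 F l e = fps_nth (fps_expansion h 0) 2"
    "A4 F l e = fps_nth (fps_expansion h 0) 3"
    using A_coefficients[OF FS f Ff le e] by (simp_all add: h_def)
  ultimately have "A2 F l z * A3 F l z - A4 F l z = fps_nth (fps_expansion h 0) 1 * fps_nth (fps_expansion h 0) 2
      - fps_nth (fps_expansion h 0) 3" by simp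
  also have "fps_nth (fps_expansion h 0) 1 * fps_nth (fps_expansion h 0) 2 - fps_nth (fps_expansion h 0) 3
      = (of_real ((1 - \<alpha>) ^ 3) * c1 ^ 3 - of_real (1 - \<alpha>) * c3) / 3"
    unfolding c1_def c3_def by (rule co)
  also have "\<dots> = of_real (- (2 * (1 - \<alpha>) / 3)) * (c3 / 2 - 4 * of_real ((1 - \<alpha>)\<^sup>2) * (c1 / 2) ^ 3)"
    by (simp add: field_simps power3_eq_cube power2_eq_square)
  finally have "cmod (A2 F l z * A3 F l z - A4 F l z) =
      2 * (1 - \<alpha>) / 3 * cmod (c3 / 2 - 4 * of_real ((1 - \<alpha>)\<^sup>2) * (c1 / 2) ^ 3)"
    using \<alpha> by (simp only: norm_mult norm_of_real) simp
  with q show ?thesis unfolding c1_def c3_def by (rule that)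
qed

section \<open>Extremal mappings\<close>

text \<open>
  For \<open>c = cos t\<close> this is the mean of \<open>(1 + \<zeta> w) / (1 - \<zeta> w)\<close> over the two points \<open>w = cis t\<close> and
  \<open>w = cis (- t)\<close>.
\<close>

definition two_point_kernel :: "real \<Rightarrow> complex \<Rightarrow> complex"
  where "two_point_kernel c \<zeta> = (1 - \<zeta>\<^sup>2) / (1 - 2 * of_real c * \<zeta> + \<zeta>\<^sup>2)"

text \<open>
  The real part equals \<open>(1 - r\<^sup>2) (1 + r\<^sup>2 - 2 c Re \<zeta>)\<close> for \<open>r = |\<zeta>|\<close>, and \<open>2 c Re \<zeta> \<le> 2 r < 1 + r\<^sup>2\<close>.
\<close>

lemma two_point_kernel_denominator:
  assumes c: "\<bar>c\<bar> \<le> 1" and \<zeta>: "cmod \<zeta> < 1"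
  shows "0 < Re ((1 - \<zeta>\<^sup>2) * cnj (1 - 2 * of_real c * \<zeta> + \<zeta>\<^sup>2))"
    and "1 - 2 * of_real c * \<zeta> + \<zeta>\<^sup>2 \<noteq> 0"
proof -
  have "Re ((1 - \<zeta>\<^sup>2) * cnj (1 - 2 * of_real c * \<zeta> + \<zeta>\<^sup>2))
      = (1 - (cmod \<zeta>)\<^sup>2) * (1 + (cmod \<zeta>)\<^sup>2 - 2 * (c * Re \<zeta>))"
    unfolding cmod_power2 by (simp add: power2_eq_square) algebra
  moreover have "0 < 1 - (cmod \<zeta>)\<^sup>2" using \<zeta> by (simp add: power_less_one_iff abs_square_less_1)
  moreover have "0 < 1 + (cmod \<zeta>)\<^sup>2 - 2 * (c * Re \<zeta>)"
  proof -
    have "\<bar>c * Re \<zeta>\<bar> \<le> 1 * cmod \<zeta>"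
      unfolding abs_mult using c abs_Re_le_cmod by (intro mult_mono) auto
    moreover have "0 < (1 - cmod \<zeta>)\<^sup>2" using \<zeta> by simp
    ultimately show ?thesis by (simp add: power2_eq_square algebra_simps abs_le_iff)
  qed
  ultimately show "0 < Re ((1 - \<zeta>\<^sup>2) * cnj (1 - 2 * of_real c * \<zeta> + \<zeta>\<^sup>2))" by simp
  then show "1 - 2 * of_real c * \<zeta> + \<zeta>\<^sup>2 \<noteq> 0"
    by (metis complex_cnj_zero less_irrefl mult_zero_right zero_complex.sel(1))
qed

lemma caratheodory_two_point_kernel:
  assumes c: "\<bar>c\<bar> \<le> 1"
  shows "caratheodory (two_point_kernel c)"
    and "caratheodory.coeff (two_point_kernel c) 1 = of_real (2 * c)"
    and "caratheodory.coeff (two_point_kernel c) 3 = of_real (8 * c ^ 3 - 6 * c)"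
    and "\<zeta> \<in> ball 0 1 \<Longrightarrow> 0 < Re (two_point_kernel c \<zeta>)"
proof -
  note den = two_point_kernel_denominator[OF c]
  have pos: "0 < Re (two_point_kernel c \<zeta>)" if "\<zeta> \<in> ball 0 1" for \<zeta>
  proof -
    have "two_point_kernel c \<zeta> = ((1 - \<zeta>\<^sup>2) * cnj (1 - 2 * of_real c * \<zeta> + \<zeta>\<^sup>2))
        / of_real ((cmod (1 - 2 * of_real c * \<zeta> + \<zeta>\<^sup>2))\<^sup>2)"
      unfolding two_point_kernel_def by (subst complex_div_cnj) simp
    moreover have "0 < (cmod (1 - 2 * of_real c * \<zeta> + \<zeta>\<^sup>2))\<^sup>2"
      using den(2)[of \<zeta>] that by simp
    ultimately show ?thesis
      using den(1)[of \<zeta>] that by (simp only: Re_divide_of_real) simp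
  qed
  then show "\<zeta> \<in> ball 0 1 \<Longrightarrow> 0 < Re (two_point_kernel c \<zeta>)" .
  show car: "caratheodory (two_point_kernel c)"
  proof
    show "two_point_kernel c holomorphic_on ball 0 1"
      unfolding two_point_kernel_def[abs_def] using den(2) by (intro holomorphic_intros) auto
  qed (use pos in \<open>auto simp: two_point_kernel_def intro: less_imp_le\<close>)
  interpret caratheodory "two_point_kernel c" by fact
  define Q where "Q = fps_expansion (two_point_kernel c) 0"
  define D :: "complex fps" where "D = 1 - fps_const (2 * of_real c) * fps_X + fps_X ^ 2"
  have 1: "(\<lambda>\<zeta>. two_point_kernel c \<zeta> * (1 - 2 * of_real c * \<zeta> + \<zeta>\<^sup>2)) has_fps_expansion Q * D"
    unfolding D_def Q_def
    by (intro fps_expansion_intros has_fps_expansion_fps_expansion[OF open_ball _ holomorphic]) auto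
  have 2: "eventually (\<lambda>\<zeta>. two_point_kernel c \<zeta> * (1 - 2 * of_real c * \<zeta> + \<zeta>\<^sup>2) = 1 - \<zeta>\<^sup>2) (nhds 0)"
    using den(2) eventually_nhds_in_open[OF open_ball, of "0::complex" 0 1]
    by (auto elim!: eventually_mono simp: two_point_kernel_def)
  have "(\<lambda>\<zeta>. 1 - \<zeta>\<^sup>2) has_fps_expansion Q * D"
    by (rule has_fps_expansion_cong[THEN iffD1, OF 2 refl 1])
  moreover have "(\<lambda>\<zeta>::complex. 1 - \<zeta>\<^sup>2) has_fps_expansion 1 - fps_X ^ 2"
    by (intro fps_expansion_intros)
  ultimately have "Q * D = 1 - fps_X ^ 2"
    using fps_expansion_eqI by metis
  then have eq: "Q - fps_const (2 * of_real c) * (fps_X * Q) + fps_X ^ 2 * Q = 1 - fps_X ^ 2"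
    by (simp add: D_def algebra_simps)
  have n0: "fps_nth Q 0 = 1"
    using arg_cong[OF eq, of "\<lambda>F. fps_nth F 0"] by simp
  have n1: "fps_nth Q 1 = 2 * of_real c"
    using arg_cong[OF eq, of "\<lambda>F. fps_nth F 1"] n0 by (simp add: fps_X_power_mult_nth)
  have "fps_nth Q 2 - 2 * of_real c * fps_nth Q 1 + 1 = - 1"
    using arg_cong[OF eq, of "\<lambda>F. fps_nth F 2"] n0 by (simp add: fps_X_power_mult_nth)
  then have n2: "fps_nth Q 2 = 2 * of_real c * fps_nth Q 1 - 2"
    by (simp add: eq_diff_eq algebra_simps)
  have "fps_nth Q 3 - 2 * of_real c * fps_nth Q 2 + fps_nth Q 1 = 0"
    using arg_cong[OF eq, of "\<lambda>F. fps_nth F 3"] by (simp add: fps_X_power_mult_nth)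
  then have n3: "fps_nth Q 3 = 2 * of_real c * fps_nth Q 2 - fps_nth Q 1"
    by (simp add: eq_diff_eq algebra_simps)
  show "coeff 1 = of_real (2 * c)" using n1 by (simp add: coeff_def Q_def)
  show "coeff 3 = of_real (8 * c ^ 3 - 6 * c)"
    unfolding coeff_def Q_def[symmetric] n3 n2 n1 by (simp add: power3_eq_cube algebra_simps)
qed

text \<open>The Sherman-Morrison formula gives the inverse.\<close>

lemma rank_one_perturbation:
  fixes L :: "'a::complex_normed_vector \<Rightarrow>\<^sub>L complex" and T :: "'a \<Rightarrow> 'a"
  assumes T: "\<And>w. T w = a *\<^sub>C w + blinfun_apply L w *\<^sub>C z" and L: "complex_linear L"
    and a: "a \<noteq> 0" "a + blinfun_apply L z \<noteq> 0"
  shows "bij T" "bounded_linear (inv T)"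
    and "inv T (a *\<^sub>C z) = (a / (a + blinfun_apply L z)) *\<^sub>C z"
proof -
  define S where "S v = (1 / a) *\<^sub>C (v - (blinfun_apply L v / (a + blinfun_apply L z)) *\<^sub>C z)" for v
  have Lc: "blinfun_apply L (c *\<^sub>C v) = c * blinfun_apply L v" for c v
    using complex_linearD[OF L] by (simp add: scaleC_complex_def)
  have TS: "T (S v) = v" for v
  proof -
    have LS: "blinfun_apply L (S v) = blinfun_apply L v / (a + blinfun_apply L z)"
      using a by (simp add: S_def Lc blinfun.diff_right field_simps)
    have "a *\<^sub>C S v = v - (blinfun_apply L v / (a + blinfun_apply L z)) *\<^sub>C z"
      using a by (simp add: S_def scaleC_scaleC)
    then show ?thesis by (simp add: T LS)
  qed
  have ST: "S (T w) = w" for w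
  proof -
    have "blinfun_apply L (T w) = blinfun_apply L w * (a + blinfun_apply L z)"
      by (simp add: T blinfun.add_right Lc algebra_simps)
    then show ?thesis using a by (simp add: S_def T scaleC_scaleC)
  qed
  show "bij T" using TS ST by (intro o_bij[of S]) auto
  have inv: "inv T = S" using TS ST by (intro inv_equality) auto
  have "bounded_linear S"
    unfolding S_def divide_inverse
    by (intro bounded_linear_compose[OF bounded_bilinear.bounded_linear_right[OF bounded_bilinear_scaleC]]
        bounded_linear_sub bounded_linear_ident
        bounded_linear_compose[OF bounded_bilinear.bounded_linear_left[OF bounded_bilinear_scaleC]]
        bounded_linear_compose[OF bounded_linear_mult_left] blinfun.bounded_linear_right)
  then show "bounded_linear (inv T)" by (simp add: inv)
  have "T ((a / (a + blinfun_apply L z)) *\<^sub>C z) = a *\<^sub>C z"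
  proof -
    have "T ((a / (a + blinfun_apply L z)) *\<^sub>C z)
        = (a * (a / (a + blinfun_apply L z)) + a / (a + blinfun_apply L z) * blinfun_apply L z) *\<^sub>C z"
      by (simp add: T Lc scaleC_scaleC scaleC_add_left)
    also have "a * (a / (a + blinfun_apply L z)) + a / (a + blinfun_apply L z) * blinfun_apply L z = a"
      using a(2) by (simp add: add_divide_distrib[symmetric] distrib_left[symmetric])
    finally show ?thesis .
  qed
  then show "inv T (a *\<^sub>C z) = (a / (a + blinfun_apply L z)) *\<^sub>C z"
    using ST inv by metis
qed

text \<open>
  A one-variable function \<open>\<phi>\<close> whose logarithmic derivative is prescribed by the kernel is lifted to
  the ball through a norming functional; along \<open>\<complex> u\<close> the lift restricts to \<open>\<phi>\<close>.
\<close>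

lemma two_point_extremal:
  fixes F :: "'a::complex_banach \<Rightarrow> 'a"
  assumes \<alpha>: "0 < \<alpha>" "\<alpha> < 1" and c: "\<bar>c\<bar> \<le> 1"
    and lu: "lu \<in> support_functionals u" and u: "norm u = 1"
    and \<phi>: "\<phi> holomorphic_on ball 0 1" "\<phi> 0 = 1" "\<And>\<zeta>. \<zeta> \<in> ball 0 1 \<Longrightarrow> \<phi> \<zeta> \<noteq> 0"
    and ode: "\<And>\<zeta>. \<zeta> \<in> ball 0 1 \<Longrightarrow>
      (of_real \<alpha> + of_real (1 - \<alpha>) * two_point_kernel c \<zeta>) * \<phi> \<zeta> = \<phi> \<zeta> + \<zeta> * deriv \<phi> \<zeta>"
    and F: "\<And>z. z \<in> ball 0 1 \<Longrightarrow> F z = \<phi> (blinfun_apply lu z) *\<^sub>C z"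
  shows "starlike_scalar_multiple \<alpha> (\<lambda>z. \<phi> (blinfun_apply lu z)) F"
    and "0 < r \<Longrightarrow> l \<in> support_functionals (r *\<^sub>R u) \<Longrightarrow>
      A2 F l (r *\<^sub>R u) * A3 F l (r *\<^sub>R u) - A4 F l (r *\<^sub>R u) =
      of_real (2 * (1 - \<alpha>) * (4 * (1 - \<alpha>)\<^sup>2 * c ^ 3 - 4 * c ^ 3 + 3 * c) / 3)"
proof -
  have ll: "complex_linear lu" and lu1: "blinfun_apply lu u = 1"
    using lu u by (auto simp: support_functionals_def)
  have lball: "blinfun_apply lu z \<in> ball 0 1" if "z \<in> ball 0 1" for z
    using support_functional_norm_le[OF lu, of z] that by simp
  define f where "f = (\<lambda>z. \<phi> (blinfun_apply lu z))"
  have df: "(f has_derivative blinfun_apply (deriv \<phi> (blinfun_apply lu z) *\<^sub>C lu)) (at z)"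
    if z: "z \<in> ball 0 1" for z
  proof -
    have "(\<phi> has_field_derivative deriv \<phi> (blinfun_apply lu z)) (at (blinfun_apply lu z))"
      by (rule holomorphic_derivI[OF \<phi>(1) open_ball lball[OF z]])
    then have "(\<phi> has_derivative (*) (deriv \<phi> (blinfun_apply lu z))) (at (blinfun_apply lu z))"
      by (rule has_field_derivative_imp_has_derivative)
    from has_derivative_compose[OF bounded_linear_imp_has_derivative[OF blinfun.bounded_linear_right] this]
    show ?thesis by (simp add: f_def scaleC_blinfun.rep_eq[abs_def] scaleC_complex_def)
  qed
  have f: "f fholomorphic_on ball 0 1"
    unfolding fholomorphic_on_def
  proof (intro ballI exI conjI)
    fix z :: 'a assume "z \<in> ball 0 1"
    then show "(f has_derivative blinfun_apply (deriv \<phi> (blinfun_apply lu z) *\<^sub>C lu)) (at z)"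
      by (rule df)
    show "complex_linear (deriv \<phi> (blinfun_apply lu z) *\<^sub>C lu)"
      using ll by (simp add: complex_linear_def scaleC_blinfun.rep_eq scaleC_complex_def)
  qed
  have Ff: "F z = f z *\<^sub>C z" if "z \<in> ball 0 1" for z
    using F[OF that] by (simp add: f_def)
  have FS: "F fholomorphic_on ball 0 1"
    by (rule fholomorphic_scalar_multiple[OF f Ff])
  have f0: "f 0 = 1" by (simp add: f_def \<phi>)
  have key: "f z \<noteq> 0" "\<alpha> < Re ((f z + blinfun_apply (fderiv f z) z) / f z)" if z: "z \<in> ball 0 1" for z
  proof -
    note b = lball[OF z]
    show fz: "f z \<noteq> 0" using \<phi>(3)[OF b] by (simp add: f_def)
    have "f z + blinfun_apply (fderiv f z) z
        = (of_real \<alpha> + of_real (1 - \<alpha>) * two_point_kernel c (blinfun_apply lu z)) * f z"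
      using ode[OF b] fderiv_eq[OF df[OF z]]
      by (simp add: scaleC_blinfun.rep_eq scaleC_complex_def f_def mult.commute)
    then have "(f z + blinfun_apply (fderiv f z) z) / f z
        = of_real \<alpha> + of_real (1 - \<alpha>) * two_point_kernel c (blinfun_apply lu z)"
      using fz by simp
    then show "\<alpha> < Re ((f z + blinfun_apply (fderiv f z) z) / f z)"
      using caratheodory_two_point_kernel(4)[OF c b] \<alpha> by (simp del: of_real_diff)
  qed
  have key2: "f z + blinfun_apply (fderiv f z) z \<noteq> 0" if "z \<in> ball 0 1" for z
    using key[OF that] \<alpha> by auto
  have cl: "complex_linear (fderiv f z)" if "z \<in> ball 0 1" for z
    by (rule fholomorphic_on_complex_linear[OF f that])
  have r1: "bij (blinfun_apply (fderiv F z))" "bounded_linear (inv (blinfun_apply (fderiv F z)))"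
    "inv (blinfun_apply (fderiv F z)) (f z *\<^sub>C z) = (f z / (f z + blinfun_apply (fderiv f z) z)) *\<^sub>C z"
    if "z \<in> ball 0 1" for z
    by ((rule rank_one_perturbation[OF fderiv_scalar_multiple[OF f Ff that] cl[OF that] key(1)[OF that]
          key2[OF that]]), assumption)+
  show "starlike_scalar_multiple \<alpha> (\<lambda>z. \<phi> (blinfun_apply lu z)) F"
    unfolding starlike_scalar_multiple_def f_def[symmetric] starlike_of_order_def mem_Collect_eq
  proof (intro conjI ballI f f0 Ff FS)
    have "blinfun_apply (fderiv F 0) w = f 0 *\<^sub>C w + blinfun_apply (fderiv f 0) w *\<^sub>C 0" for w
      by (rule fderiv_scalar_multiple[OF f Ff]) auto
    then show "normalized F"
      unfolding normalized_def by (intro conjI blinfun_eqI) (simp_all add: Ff f0)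
    show "locally_biholomorphic F"
      unfolding locally_biholomorphic_def using r1(1,2) by blast
    fix z and l :: "'a \<Rightarrow>\<^sub>L complex"
    assume "z \<in> ball 0 1 - {0}" and l: "l \<in> support_functionals z"
    then have z: "z \<in> ball 0 1" and z0: "z \<noteq> 0" by auto
    define k where "k = f z / (f z + blinfun_apply (fderiv f z) z)"
    have k0: "k \<noteq> 0" using key(1)[OF z] key2[OF z] by (simp add: k_def)
    have "complex_of_real (1 / norm z) * blinfun_apply l (inv (blinfun_apply (fderiv F z)) (F z)) = k"
      using l z0 unfolding Ff[OF z] r1(3)[OF z]
      by (simp add: support_functionals_def complex_linear_def k_def[symmetric] scaleC_complex_def)
    moreover have "\<alpha> < Re (1 / k)" using key(2)[OF z] by (simp add: k_def)
    ultimately show "cmod (complex_of_real (1 / norm z)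
        * blinfun_apply l (inv (blinfun_apply (fderiv F z)) (F z)) - complex_of_real (1 / (2 * \<alpha>))) < 1 / (2 * \<alpha>)"
      using disc_iff_Re_inverse[OF \<alpha>(1) k0] by simp
  qed
  assume r: "0 < r" and l: "l \<in> support_functionals (r *\<^sub>R u)"
  then have l: "l \<in> support_functionals u" by (simp add: support_functionals_scaleR)
  have slice: "(\<lambda>\<zeta>. f (\<zeta> *\<^sub>C u)) = \<phi>"
    by (simp add: f_def complex_linearD[OF ll] lu1 scaleC_complex_def)
  note kern = caratheodory_two_point_kernel[OF c]
  have "A2 F l u = fps_nth (fps_expansion \<phi> 0) 1" "A3 F l u = fps_nth (fps_expansion \<phi> 0) 2"
    "A4 F l u = fps_nth (fps_expansion \<phi> 0) 3"
    using A_coefficients[OF FS f Ff l u] by (simp_all add: slice)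
  then have "A2 F l u * A3 F l u - A4 F l u = fps_nth (fps_expansion \<phi> 0) 1 * fps_nth (fps_expansion \<phi> 0) 2
      - fps_nth (fps_expansion \<phi> 0) 3" by simp
  also have "\<dots> = (of_real ((1 - \<alpha>) ^ 3) * of_real (2 * c) ^ 3 - of_real (1 - \<alpha>) * of_real (8 * c ^ 3 - 6 * c)) / 3"
    unfolding kern(2,3)[symmetric]
    by (rule order_coefficients[OF \<phi>(1,2) kern(1) ode])
  also have "\<dots> = of_real (2 * (1 - \<alpha>) * (4 * (1 - \<alpha>)\<^sup>2 * c ^ 3 - 4 * c ^ 3 + 3 * c) / 3)"
    by (simp add: power3_eq_cube power2_eq_square algebra_simps)
  finally show "A2 F l (r *\<^sub>R u) * A3 F l (r *\<^sub>R u) - A4 F l (r *\<^sub>R u) =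
      of_real (2 * (1 - \<alpha>) * (4 * (1 - \<alpha>)\<^sup>2 * c ^ 3 - 4 * c ^ 3 + 3 * c) / 3)"
    using r by (simp only: A_scaleR)
qed

text \<open>
  Both extremal mappings are given by the exponential of a logarithm \<open>\<Psi>\<close> of \<open>\<phi>\<close>, for which the
  condition on the logarithmic derivative is linear.
\<close>

lemma exponential_extremal:
  fixes F :: "'a::complex_banach \<Rightarrow> 'a"
  assumes \<alpha>: "0 < \<alpha>" "\<alpha> < 1" and c: "\<bar>c\<bar> \<le> 1"
    and lu: "lu \<in> support_functionals u" and u: "norm u = 1"
    and \<Psi>: "\<And>\<zeta>. \<zeta> \<in> ball 0 1 \<Longrightarrow> (\<Psi> has_field_derivative \<psi> \<zeta>) (at \<zeta>)" "\<Psi> 0 = 0"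
    and \<psi>: "\<And>\<zeta>. \<zeta> \<in> ball 0 1 \<Longrightarrow> \<zeta> * \<psi> \<zeta> = of_real (1 - \<alpha>) * (two_point_kernel c \<zeta> - 1)"
    and F: "\<And>z. z \<in> ball 0 1 \<Longrightarrow> F z = exp (\<Psi> (blinfun_apply lu z)) *\<^sub>C z"
  shows "\<exists>f. starlike_scalar_multiple \<alpha> f F"
    and "0 < r \<Longrightarrow> l \<in> support_functionals (r *\<^sub>R u) \<Longrightarrow>
      A2 F l (r *\<^sub>R u) * A3 F l (r *\<^sub>R u) - A4 F l (r *\<^sub>R u) =
      of_real (2 * (1 - \<alpha>) * (4 * (1 - \<alpha>)\<^sup>2 * c ^ 3 - 4 * c ^ 3 + 3 * c) / 3)"
proof -
  define \<phi> where "\<phi> = (\<lambda>\<zeta>. exp (\<Psi> \<zeta>))"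
  have d: "(\<phi> has_field_derivative exp (\<Psi> \<zeta>) * \<psi> \<zeta>) (at \<zeta>)" if "\<zeta> \<in> ball 0 1" for \<zeta>
    unfolding \<phi>_def by (rule DERIV_fun_exp[OF \<Psi>(1)[OF that]])
  have hol: "\<phi> holomorphic_on ball 0 1"
    unfolding holomorphic_on_open[OF open_ball] using d by blast
  have ode: "(of_real \<alpha> + of_real (1 - \<alpha>) * two_point_kernel c \<zeta>) * \<phi> \<zeta> = \<phi> \<zeta> + \<zeta> * deriv \<phi> \<zeta>"
    if "\<zeta> \<in> ball 0 1" for \<zeta>
  proof -
    have "deriv \<phi> \<zeta> = \<phi> \<zeta> * \<psi> \<zeta>"
      using DERIV_imp_deriv[OF d[OF that]] by (simp add: \<phi>_def)
    then have "\<phi> \<zeta> + \<zeta> * deriv \<phi> \<zeta> = (1 + \<zeta> * \<psi> \<zeta>) * \<phi> \<zeta>"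
      by (simp add: algebra_simps)
    also have "1 + \<zeta> * \<psi> \<zeta> = of_real \<alpha> + of_real (1 - \<alpha>) * two_point_kernel c \<zeta>"
      unfolding \<psi>[OF that] by (simp add: algebra_simps)
    finally show ?thesis by simp
  qed
  note extremal = two_point_extremal[OF \<alpha> c lu u hol _ _ ode, of F]
  show "\<exists>f. starlike_scalar_multiple \<alpha> f F"
    by (rule exI, rule extremal(1)) (auto simp: \<phi>_def \<Psi>(2) F)
  show "0 < r \<Longrightarrow> l \<in> support_functionals (r *\<^sub>R u) \<Longrightarrow>
      A2 F l (r *\<^sub>R u) * A3 F l (r *\<^sub>R u) - A4 F l (r *\<^sub>R u) =
      of_real (2 * (1 - \<alpha>) * (4 * (1 - \<alpha>)\<^sup>2 * c ^ 3 - 4 * c ^ 3 + 3 * c) / 3)"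
    by (rule extremal(2)) (auto simp: \<phi>_def \<Psi>(2) F)
qed

section \<open>The sharp bounds\<close>

lemma \<alpha>\<^sub>1_root: "4 * \<alpha>\<^sub>1\<^sup>2 - 8 * \<alpha>\<^sub>1 + 1 = 0"
  by (simp add: \<alpha>\<^sub>1_def power2_eq_square field_simps)

lemma le_\<alpha>\<^sub>1_iff:
  assumes "\<alpha> < 1"
  shows "\<alpha> \<le> \<alpha>\<^sub>1 \<longleftrightarrow> 3 / 4 \<le> (1 - \<alpha>)\<^sup>2"
proof -
  have "\<alpha> \<le> \<alpha>\<^sub>1 \<longleftrightarrow> sqrt 3 / 2 \<le> 1 - \<alpha>" by (auto simp: \<alpha>\<^sub>1_def)
  also have "\<dots> \<longleftrightarrow> (sqrt 3 / 2)\<^sup>2 \<le> (1 - \<alpha>)\<^sup>2"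
    using assms power_mono_iff[of "sqrt 3 / 2" "1 - \<alpha>" 2] by simp
  finally show ?thesis by (simp add: power_divide)
qed

lemma starlike_bound_small:
  fixes f :: "'a::complex_banach \<Rightarrow> complex"
  assumes F: "starlike_scalar_multiple \<alpha> f F" and \<alpha>: "0 < \<alpha>" "\<alpha> < 1" "\<alpha> \<le> \<alpha>\<^sub>1"
    and l: "l \<in> support_functionals z" and z: "z \<noteq> 0"
  shows "cmod (A2 F l z * A3 F l z - A4 F l z) \<le> 2 * (3 - 11 * \<alpha> + 12 * \<alpha>\<^sup>2 - 4 * \<alpha> ^ 3) / 3"
proof -
  obtain q where q: "caratheodory q"
    and eq: "cmod (A2 F l z * A3 F l z - A4 F l z) = 2 * (1 - \<alpha>) / 3 *
      cmod (caratheodory.coeff q 3 / 2 - 4 * of_real ((1 - \<alpha>)\<^sup>2) * (caratheodory.coeff q 1 / 2) ^ 3)"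
    using starlike_caratheodory[OF F \<alpha>(1,2) l z] by blast
  have "3 / 4 \<le> (1 - \<alpha>)\<^sup>2" "(1 - \<alpha>)\<^sup>2 \<le> 1"
    using \<alpha> le_\<alpha>\<^sub>1_iff[OF \<alpha>(2)] by (auto simp: power_le_one)
  then have "cmod (A2 F l z * A3 F l z - A4 F l z) \<le> 2 * (1 - \<alpha>) / 3 * (4 * (1 - \<alpha>)\<^sup>2 - 1)"
    unfolding eq using \<alpha> by (intro mult_left_mono caratheodory_third_coefficient_bound_large q) auto
  also have "\<dots> = 2 * (3 - 11 * \<alpha> + 12 * \<alpha>\<^sup>2 - 4 * \<alpha> ^ 3) / 3"
    by (simp add: power2_eq_square power3_eq_cube field_simps)
  finally show ?thesis .
qed

lemma starlike_bound_large:
  fixes f :: "'a::complex_banach \<Rightarrow> complex"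
  assumes F: "starlike_scalar_multiple \<alpha> f F" and \<alpha>: "0 < \<alpha>" "\<alpha> < 1" "\<alpha>\<^sub>1 \<le> \<alpha>"
    and l: "l \<in> support_functionals z" and z: "z \<noteq> 0"
  shows "cmod (A2 F l z * A3 F l z - A4 F l z) \<le> 2 * (1 - \<alpha>) / (3 * sqrt (\<alpha> * (2 - \<alpha>)))"
proof -
  obtain q where q: "caratheodory q"
    and eq: "cmod (A2 F l z * A3 F l z - A4 F l z) = 2 * (1 - \<alpha>) / 3 *
      cmod (caratheodory.coeff q 3 / 2 - 4 * of_real ((1 - \<alpha>)\<^sup>2) * (caratheodory.coeff q 1 / 2) ^ 3)"
    using starlike_caratheodory[OF F \<alpha>(1,2) l z] by blast
  have "(1 - \<alpha>)\<^sup>2 \<le> (1 - \<alpha>\<^sub>1)\<^sup>2"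
    using \<alpha> by (intro power_mono) auto
  also have "\<dots> = 3 / 4" using \<alpha>\<^sub>1_root by (simp add: power2_eq_square algebra_simps)
  finally have "cmod (A2 F l z * A3 F l z - A4 F l z) \<le> 2 * (1 - \<alpha>) / 3 * (1 / sqrt (1 - (1 - \<alpha>)\<^sup>2))"
    unfolding eq using \<alpha> by (intro mult_left_mono caratheodory_third_coefficient_bound_small q) auto
  also have "1 - (1 - \<alpha>)\<^sup>2 = \<alpha> * (2 - \<alpha>)" by (simp add: power2_eq_square algebra_simps)
  finally show ?thesis by simp
qed

text \<open>
  The two points of the kernel coincide for \<open>c = 1\<close>, where it becomes \<open>(1 + \<zeta>) / (1 - \<zeta>)\<close>.  The
  hypothesis \<open>\<alpha> \<le> \<alpha>\<^sub>1\<close> of the second part makes the value of the functional nonnegative.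
\<close>

lemma extremal_F2_sharp:
  fixes u :: "'a::complex_banach"
  assumes \<alpha>: "0 < \<alpha>" "\<alpha> < 1" and lu: "lu \<in> support_functionals u" and u: "norm u = 1"
  shows "\<exists>f. starlike_scalar_multiple \<alpha> f (extremal_F2 \<alpha> lu)"
    and "\<alpha> \<le> \<alpha>\<^sub>1 \<Longrightarrow> 0 < r \<Longrightarrow> l \<in> support_functionals (r *\<^sub>R u) \<Longrightarrow>
      cmod (A2 (extremal_F2 \<alpha> lu) l (r *\<^sub>R u) * A3 (extremal_F2 \<alpha> lu) l (r *\<^sub>R u)
        - A4 (extremal_F2 \<alpha> lu) l (r *\<^sub>R u)) = 2 * (3 - 11 * \<alpha> + 12 * \<alpha>\<^sup>2 - 4 * \<alpha> ^ 3) / 3"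
proof -
  have Re1: "0 < Re (1 - \<zeta>)" if "\<zeta> \<in> ball 0 1" for \<zeta> :: complex
    using complex_Re_le_cmod[of \<zeta>] that by simp
  have ne1: "\<zeta> \<noteq> 1" if "\<zeta> \<in> ball 0 1" for \<zeta> :: complex
    using that by auto
  define \<Psi> :: "complex \<Rightarrow> complex" where "\<Psi> \<zeta> = - (of_real (2 * (1 - \<alpha>)) * Ln (1 - \<zeta>))" for \<zeta>
  have \<Psi>: "(\<Psi> has_field_derivative of_real (2 * (1 - \<alpha>)) / (1 - \<zeta>)) (at \<zeta>)" if "\<zeta> \<in> ball 0 1" for \<zeta>
  proof -
    have "1 - \<zeta> \<notin> \<real>\<^sub>\<le>\<^sub>0" using Re1[OF that] by (auto simp: complex_nonpos_Reals_iff)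
    then have "((\<lambda>\<zeta>. - (b * Ln (1 - \<zeta>))) has_field_derivative b / (1 - \<zeta>)) (at \<zeta>)" for b
      by (auto intro!: derivative_eq_intros simp: divide_inverse)
    then show ?thesis unfolding \<Psi>_def .
  qed
  have kernel: "\<zeta> * (of_real (2 * (1 - \<alpha>)) / (1 - \<zeta>)) = of_real (1 - \<alpha>) * (two_point_kernel 1 \<zeta> - 1)"
    if "\<zeta> \<in> ball 0 1" for \<zeta>
  proof -
    have "1 - 2 * of_real 1 * \<zeta> + \<zeta>\<^sup>2 = (1 - \<zeta>) * (1 - \<zeta>)" "1 - \<zeta>\<^sup>2 = (1 - \<zeta>) * (1 + \<zeta>)"
      by (simp_all add: power2_eq_square algebra_simps)
    then have "two_point_kernel 1 \<zeta> = (1 + \<zeta>) / (1 - \<zeta>)"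
      using ne1[OF that] by (simp add: two_point_kernel_def)
    moreover have "(1 + \<zeta>) / (1 - \<zeta>) - 1 = 2 * \<zeta> / (1 - \<zeta>)"
      using ne1[OF that] by (simp add: field_simps)
    ultimately have k: "two_point_kernel 1 \<zeta> - 1 = 2 * \<zeta> / (1 - \<zeta>)" by (simp only:)
    show ?thesis
      unfolding k by (simp only: of_real_mult of_real_numeral times_divide_eq_right mult_ac)
  qed
  have F2: "extremal_F2 \<alpha> lu z = exp (\<Psi> (blinfun_apply lu z)) *\<^sub>C z" if "z \<in> ball 0 1" for z
  proof -
    have "blinfun_apply lu z \<in> ball 0 1"
      using support_functional_norm_le[OF lu, of z] that by simp
    from ne1[OF this] show ?thesis
      by (simp add: extremal_F2_def \<Psi>_def powr_def exp_minus inverse_eq_divide)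
  qed
  have c: "\<bar>1::real\<bar> \<le> 1" and \<Psi>0: "\<Psi> 0 = 0" by (simp_all add: \<Psi>_def)
  note ext = exponential_extremal[OF \<alpha> c lu u \<Psi> \<Psi>0 kernel F2]
  show "\<exists>f. starlike_scalar_multiple \<alpha> f (extremal_F2 \<alpha> lu)" by (rule ext(1))
  assume a1: "\<alpha> \<le> \<alpha>\<^sub>1" and rl: "0 < r" "l \<in> support_functionals (r *\<^sub>R u)"
  have "0 \<le> 2 * (1 - \<alpha>) * (4 * (1 - \<alpha>)\<^sup>2 * 1 ^ 3 - 4 * 1 ^ 3 + 3 * 1) / 3"
    using a1 \<alpha> le_\<alpha>\<^sub>1_iff[OF \<alpha>(2)] by (intro divide_nonneg_nonneg mult_nonneg_nonneg) auto
  then have "cmod (A2 (extremal_F2 \<alpha> lu) l (r *\<^sub>R u) * A3 (extremal_F2 \<alpha> lu) l (r *\<^sub>R u)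
        - A4 (extremal_F2 \<alpha> lu) l (r *\<^sub>R u)) = 2 * (1 - \<alpha>) * (4 * (1 - \<alpha>)\<^sup>2 * 1 ^ 3 - 4 * 1 ^ 3 + 3 * 1) / 3"
    by (subst ext(2)[OF _ _ _ rl]) (simp_all only: norm_of_real abs_of_nonneg)
  also have "\<dots> = 2 * (3 - 11 * \<alpha> + 12 * \<alpha>\<^sup>2 - 4 * \<alpha> ^ 3) / 3"
    by (simp add: power2_eq_square power3_eq_cube algebra_simps)
  finally show "cmod (A2 (extremal_F2 \<alpha> lu) l (r *\<^sub>R u) * A3 (extremal_F2 \<alpha> lu) l (r *\<^sub>R u)
        - A4 (extremal_F2 \<alpha> lu) l (r *\<^sub>R u)) = 2 * (3 - 11 * \<alpha> + 12 * \<alpha>\<^sup>2 - 4 * \<alpha> ^ 3) / 3" .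
qed

text \<open>
  The condition \<open>\<alpha>\<^sub>1 < \<alpha>\<close> guarantees \<open>\<rho> \<alpha> \<le> 1\<close>, so that \<open>\<rho> \<alpha>\<close> is a cosine.  The integrand is
  then holomorphic in the disc, and its integral does not depend on the path.
\<close>

lemma extremal_F3_sharp:
  fixes u :: "'a::complex_banach"
  assumes \<alpha>: "0 < \<alpha>" "\<alpha> < 1" "\<alpha>\<^sub>1 < \<alpha>" and lu: "lu \<in> support_functionals u" and u: "norm u = 1"
    and \<gamma>: "integration_paths lu \<gamma>"
  shows "\<exists>f. starlike_scalar_multiple \<alpha> f (extremal_F3 \<alpha> \<gamma>)"
    and "0 < r \<Longrightarrow> l \<in> support_functionals (r *\<^sub>R u) \<Longrightarrow>
      cmod (A2 (extremal_F3 \<alpha> \<gamma>) l (r *\<^sub>R u) * A3 (extremal_F3 \<alpha> \<gamma>) l (r *\<^sub>R u)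
        - A4 (extremal_F3 \<alpha> \<gamma>) l (r *\<^sub>R u)) = 2 * (1 - \<alpha>) / (3 * sqrt (\<alpha> * (2 - \<alpha>)))"
proof -
  define \<kappa> where "\<kappa> = sqrt (\<alpha> * (2 - \<alpha>))"
  have \<kappa>2: "\<kappa>\<^sup>2 = 1 - (1 - \<alpha>)\<^sup>2" and \<kappa>0: "0 < \<kappa>"
    using \<alpha> by (simp_all add: \<kappa>_def power2_eq_square algebra_simps)
  have \<rho>: "\<rho> \<alpha> = 1 / (2 * \<kappa>)" by (simp add: \<rho>_def \<kappa>_def)
  have "(1 / 2)\<^sup>2 \<le> \<kappa>\<^sup>2"
    using \<alpha> le_\<alpha>\<^sub>1_iff[OF \<alpha>(2)] unfolding \<kappa>2 by (simp add: power_divide)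
  then have "1 / 2 \<le> \<kappa>" by (rule power2_le_imp_le) (use \<kappa>0 in simp)
  then have c: "\<bar>\<rho> \<alpha>\<bar> \<le> 1" using \<kappa>0 by (simp add: \<rho> field_simps)
  have den: "t\<^sup>2 - 2 * t * complex_of_real (\<rho> \<alpha>) + 1 = 1 - 2 * of_real (\<rho> \<alpha>) * t + t\<^sup>2" for t
    by (simp add: algebra_simps)
  have ne: "1 - 2 * of_real (\<rho> \<alpha>) * \<zeta> + \<zeta>\<^sup>2 \<noteq> 0" if "\<zeta> \<in> ball 0 1" for \<zeta> :: complex
    using two_point_kernel_denominator(2)[OF c] that by simp
  have "F3_integrand \<alpha> holomorphic_on ball 0 1"
    unfolding F3_integrand_def[abs_def] den using ne by (intro holomorphic_intros) auto
  then obtain P where P: "\<And>x. x \<in> ball 0 1 \<Longrightarrow> (P has_field_derivative F3_integrand \<alpha> x) (at x within ball 0 1)"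
    using holomorphic_convex_primitive'[OF convex_ball open_ball] by metis
  define \<Psi> where "\<Psi> \<zeta> = P \<zeta> - P 0" for \<zeta>
  have \<Psi>: "(\<Psi> has_field_derivative F3_integrand \<alpha> \<zeta>) (at \<zeta>)" if "\<zeta> \<in> ball 0 1" for \<zeta>
    using P[OF that] that unfolding \<Psi>_def
    by (auto intro!: derivative_eq_intros simp: at_within_open[OF _ open_ball])
  have \<Psi>0: "\<Psi> 0 = 0" by (simp add: \<Psi>_def)
  have kernel: "\<zeta> * F3_integrand \<alpha> \<zeta> = of_real (1 - \<alpha>) * (two_point_kernel (\<rho> \<alpha>) \<zeta> - 1)"
    if "\<zeta> \<in> ball 0 1" for \<zeta>
  proof -
    have "two_point_kernel (\<rho> \<alpha>) \<zeta> - 1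
        = (2 * \<zeta> * (of_real (\<rho> \<alpha>) - \<zeta>)) / (1 - 2 * of_real (\<rho> \<alpha>) * \<zeta> + \<zeta>\<^sup>2)"
      using ne[OF that] by (simp add: two_point_kernel_def field_simps power2_eq_square)
    then show ?thesis by (simp add: F3_integrand_def den, simp add: algebra_simps)
  qed
  have F3: "extremal_F3 \<alpha> \<gamma> z = exp (\<Psi> (blinfun_apply lu z)) *\<^sub>C z" if z: "z \<in> ball 0 1" for z
  proof -
    have g: "valid_path (\<gamma> z)" "path_image (\<gamma> z) \<subseteq> ball 0 1" "pathstart (\<gamma> z) = 0"
      "pathfinish (\<gamma> z) = blinfun_apply lu z"
      using \<gamma> z by (auto simp: integration_paths_def)
    have "contour_integral (\<gamma> z) (F3_integrand \<alpha>) = \<Psi> (blinfun_apply lu z)"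
      using contour_integral_unique[OF contour_integral_primitive[OF P g(1,2)]] g(3,4)
      by (simp add: \<Psi>_def)
    then show ?thesis by (simp add: extremal_F3_def)
  qed
  note ext = exponential_extremal[OF \<alpha>(1,2) c lu u \<Psi> \<Psi>0 kernel F3]
  show "\<exists>f. starlike_scalar_multiple \<alpha> f (extremal_F3 \<alpha> \<gamma>)" by (rule ext(1))
  assume rl: "0 < r" "l \<in> support_functionals (r *\<^sub>R u)"
  have "4 * (1 - \<alpha>)\<^sup>2 * \<rho> \<alpha> ^ 3 - 4 * \<rho> \<alpha> ^ 3 + 3 * \<rho> \<alpha> = 3 * \<rho> \<alpha> - 4 * (\<kappa>\<^sup>2 * \<rho> \<alpha> ^ 3)"
    unfolding \<kappa>2 by (simp add: algebra_simps)
  also have "\<dots> = 1 / \<kappa>"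
    using \<kappa>0 by (simp add: \<rho> power2_eq_square power3_eq_cube field_simps)
  finally have "2 * (1 - \<alpha>) * (4 * (1 - \<alpha>)\<^sup>2 * \<rho> \<alpha> ^ 3 - 4 * \<rho> \<alpha> ^ 3 + 3 * \<rho> \<alpha>) / 3
      = 2 * (1 - \<alpha>) / (3 * \<kappa>)" by simp
  moreover have "0 \<le> 2 * (1 - \<alpha>) / (3 * \<kappa>)" using \<alpha> \<kappa>0 by simp
  ultimately show "cmod (A2 (extremal_F3 \<alpha> \<gamma>) l (r *\<^sub>R u) * A3 (extremal_F3 \<alpha> \<gamma>) l (r *\<^sub>R u)
        - A4 (extremal_F3 \<alpha> \<gamma>) l (r *\<^sub>R u)) = 2 * (1 - \<alpha>) / (3 * sqrt (\<alpha> * (2 - \<alpha>)))"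
    by (subst ext(2)[OF _ _ _ rl]) (simp_all only: norm_of_real abs_of_nonneg \<kappa>_def)
qed

lemma bounds_agree_at_\<alpha>\<^sub>1:
  "2 * (3 - 11 * \<alpha>\<^sub>1 + 12 * \<alpha>\<^sub>1\<^sup>2 - 4 * \<alpha>\<^sub>1 ^ 3) / 3 = 2 * (1 - \<alpha>\<^sub>1) / (3 * sqrt (\<alpha>\<^sub>1 * (2 - \<alpha>\<^sub>1)))"
proof -
  have "\<alpha>\<^sub>1 * (2 - \<alpha>\<^sub>1) = (1 / 2)\<^sup>2"
    using \<alpha>\<^sub>1_root by (simp add: power2_eq_square algebra_simps)
  then have root: "sqrt (\<alpha>\<^sub>1 * (2 - \<alpha>\<^sub>1)) = 1 / 2" by (simp only: real_sqrt_abs)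
  have cubic: "3 - 11 * \<alpha>\<^sub>1 + 12 * \<alpha>\<^sub>1\<^sup>2 - 4 * \<alpha>\<^sub>1 ^ 3 = 2 * (1 - \<alpha>\<^sub>1) + (1 - \<alpha>\<^sub>1) * (4 * \<alpha>\<^sub>1\<^sup>2 - 8 * \<alpha>\<^sub>1 + 1)"
    by (simp add: power2_eq_square power3_eq_cube algebra_simps)
  show ?thesis unfolding cubic root \<alpha>\<^sub>1_root by (simp add: algebra_simps)
qed

text \<open>Here \<open>q5 \<alpha> = 2\<close> and \<open>q6 \<alpha> = 1 - 4 (1 - \<alpha>)\<^sup>2\<close>; the relevant boundary is \<open>q6 \<alpha> = - 2\<close>.\<close>

lemma q5_q6_regions:
  assumes "0 < \<alpha>" "\<alpha> < 1"
  shows "\<alpha> \<le> \<alpha>\<^sub>1 \<Longrightarrow> (q5 \<alpha>, q6 \<alpha>) \<in> \<Theta>4" "\<alpha>\<^sub>1 < \<alpha> \<Longrightarrow> (q5 \<alpha>, q6 \<alpha>) \<in> \<Theta>8"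
proof -
  have "q5 \<alpha> = 2" using assms by (simp add: q5_def B_eq field_simps)
  moreover have "q6 \<alpha> = 1 - 4 * (1 - \<alpha>)\<^sup>2"
    using assms by (simp add: q6_def B_eq field_simps power2_eq_square power3_eq_cube)
  moreover have "0 \<le> (1 - \<alpha>)\<^sup>2" by simp
  ultimately show "\<alpha> \<le> \<alpha>\<^sub>1 \<Longrightarrow> (q5 \<alpha>, q6 \<alpha>) \<in> \<Theta>4" "\<alpha>\<^sub>1 < \<alpha> \<Longrightarrow> (q5 \<alpha>, q6 \<alpha>) \<in> \<Theta>8"
    using le_\<alpha>\<^sub>1_iff[OF assms(2)] by (auto simp: \<Theta>4_def \<Theta>8_def)
qed

theorem corollary7p2:
  fixes \<alpha> :: real
  assumes nonzero: "\<exists>x::'a::complex_banach. x \<noteq> 0"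
    and alpha: "0 < \<alpha>" "\<alpha> < 1"
  shows
    "4 * \<alpha>\<^sub>1\<^sup>2 - 8 * \<alpha>\<^sub>1 + 1 = 0 \<and>
     (\<forall>(f :: 'a \<Rightarrow> complex) F z. \<forall>l\<in>support_functionals z.
        starlike_scalar_multiple \<alpha> f F \<longrightarrow> z \<noteq> 0 \<longrightarrow>
          (\<alpha> \<le> \<alpha>\<^sub>1 \<longrightarrow>
            cmod (A2 F l z * A3 F l z - A4 F l z)
              \<le> 2 * (3 - 11 * \<alpha> + 12 * \<alpha>\<^sup>2 - 4 * \<alpha> ^ 3) / 3) \<and>
          (\<alpha>\<^sub>1 \<le> \<alpha> \<longrightarrow>
            cmod (A2 F l z * A3 F l z - A4 F l z)
              \<le> 2 * (1 - \<alpha>) / (3 * sqrt (\<alpha> * (2 - \<alpha>))))) \<and>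
     (\<forall>(u :: 'a). \<forall>lu\<in>support_functionals u. norm u = 1 \<longrightarrow>
        (\<alpha> \<le> \<alpha>\<^sub>1 \<longrightarrow>
          (q5 \<alpha>, q6 \<alpha>) \<in> \<Theta>4 \<and>
          (\<exists>f. starlike_scalar_multiple \<alpha> f (extremal_F2 \<alpha> lu)) \<and>
          (\<forall>r. 0 < r \<and> r < 1 \<longrightarrow> (\<forall>l\<in>support_functionals (r *\<^sub>R u).
            cmod (A2 (extremal_F2 \<alpha> lu) l (r *\<^sub>R u) * A3 (extremal_F2 \<alpha> lu) l (r *\<^sub>R u)
                  - A4 (extremal_F2 \<alpha> lu) l (r *\<^sub>R u))
              = 2 * (3 - 11 * \<alpha> + 12 * \<alpha>\<^sup>2 - 4 * \<alpha> ^ 3) / 3))) \<and>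
        (\<alpha>\<^sub>1 < \<alpha> \<longrightarrow>
          (q5 \<alpha>, q6 \<alpha>) \<in> \<Theta>8 \<and>
          (\<forall>\<gamma>. integration_paths lu \<gamma> \<longrightarrow>
            (\<exists>f. starlike_scalar_multiple \<alpha> f (extremal_F3 \<alpha> \<gamma>)) \<and>
            (\<forall>r. 0 < r \<and> r < 1 \<longrightarrow> (\<forall>l\<in>support_functionals (r *\<^sub>R u).
              cmod (A2 (extremal_F3 \<alpha> \<gamma>) l (r *\<^sub>R u) * A3 (extremal_F3 \<alpha> \<gamma>) l (r *\<^sub>R u)
                    - A4 (extremal_F3 \<alpha> \<gamma>) l (r *\<^sub>R u))
                = 2 * (1 - \<alpha>) / (3 * sqrt (\<alpha> * (2 - \<alpha>)))))))) \<and>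
     (\<exists>(f :: 'a \<Rightarrow> complex) F z. \<exists>l\<in>support_functionals z.
        starlike_scalar_multiple \<alpha> f F \<and> z \<noteq> 0 \<and>
          (\<alpha> \<le> \<alpha>\<^sub>1 \<longrightarrow>
            cmod (A2 F l z * A3 F l z - A4 F l z)
              = 2 * (3 - 11 * \<alpha> + 12 * \<alpha>\<^sup>2 - 4 * \<alpha> ^ 3) / 3) \<and>
          (\<alpha>\<^sub>1 \<le> \<alpha> \<longrightarrow>
            cmod (A2 F l z * A3 F l z - A4 F l z)
              = 2 * (1 - \<alpha>) / (3 * sqrt (\<alpha> * (2 - \<alpha>)))))"
proof (intro conjI allI ballI impI)
  show "4 * \<alpha>\<^sub>1\<^sup>2 - 8 * \<alpha>\<^sub>1 + 1 = 0" by (rule \<alpha>\<^sub>1_root)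
next
  obtain x :: 'a where x: "x \<noteq> 0" using nonzero by blast
  define u where "u = (1 / norm x) *\<^sub>R x"
  have u: "norm u = 1" using x by (simp add: u_def)
  then have "u \<noteq> 0" by auto
  then obtain lu where lu: "lu \<in> support_functionals u"
    using support_functionals_nonempty by blast
  have half: "(1 / 2) *\<^sub>R u \<noteq> 0" and lh: "lu \<in> support_functionals ((1 / 2) *\<^sub>R u)"
    using \<open>u \<noteq> 0\<close> lu by (simp_all add: support_functionals_scaleR)
  show "\<exists>(f :: 'a \<Rightarrow> complex) F z. \<exists>l\<in>support_functionals z.
        starlike_scalar_multiple \<alpha> f F \<and> z \<noteq> 0 \<and>
          (\<alpha> \<le> \<alpha>\<^sub>1 \<longrightarrow>
            cmod (A2 F l z * A3 F l z - A4 F l z)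
              = 2 * (3 - 11 * \<alpha> + 12 * \<alpha>\<^sup>2 - 4 * \<alpha> ^ 3) / 3) \<and>
          (\<alpha>\<^sub>1 \<le> \<alpha> \<longrightarrow>
            cmod (A2 F l z * A3 F l z - A4 F l z)
              = 2 * (1 - \<alpha>) / (3 * sqrt (\<alpha> * (2 - \<alpha>))))"
  proof (cases "\<alpha> \<le> \<alpha>\<^sub>1")
    case True
    obtain f where f: "starlike_scalar_multiple \<alpha> f (extremal_F2 \<alpha> lu)"
      using extremal_F2_sharp(1)[OF alpha lu u] by blast
    have sharp: "cmod (A2 (extremal_F2 \<alpha> lu) lu ((1 / 2) *\<^sub>R u) * A3 (extremal_F2 \<alpha> lu) lu ((1 / 2) *\<^sub>R u)
        - A4 (extremal_F2 \<alpha> lu) lu ((1 / 2) *\<^sub>R u)) = 2 * (3 - 11 * \<alpha> + 12 * \<alpha>\<^sup>2 - 4 * \<alpha> ^ 3) / 3"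
      by (rule extremal_F2_sharp(2)[OF alpha lu u True _ lh]) simp
    have agree: "2 * (3 - 11 * \<alpha> + 12 * \<alpha>\<^sup>2 - 4 * \<alpha> ^ 3) / 3 = 2 * (1 - \<alpha>) / (3 * sqrt (\<alpha> * (2 - \<alpha>)))"
      if "\<alpha>\<^sub>1 \<le> \<alpha>"
      using bounds_agree_at_\<alpha>\<^sub>1 antisym[OF True that] by (simp only:)
    show ?thesis
      by (intro exI[of _ f] exI[of _ "extremal_F2 \<alpha> lu"] exI[of _ "(1 / 2) *\<^sub>R u"] bexI[of _ lu]
          conjI impI f half lh sharp trans[OF sharp agree])
  next
    case False
    \<comment> \<open>Some choice of integration paths is needed; straight segments stay in the disc.\<close>
    define \<gamma> where "\<gamma> z = linepath 0 (blinfun_apply lu z)" for z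
    have "integration_paths lu \<gamma>"
      unfolding integration_paths_def \<gamma>_def
    proof (intro ballI conjI)
      fix z :: 'a assume "z \<in> ball 0 1"
      then have "blinfun_apply lu z \<in> ball 0 1"
        using support_functional_norm_le[OF lu, of z] by simp
      then show "path_image (linepath 0 (blinfun_apply lu z)) \<subseteq> ball 0 1"
        by (simp add: closed_segment_subset)
    qed auto
    with False have \<gamma>: "\<alpha>\<^sub>1 < \<alpha>" "integration_paths lu \<gamma>" by auto
    obtain f where f: "starlike_scalar_multiple \<alpha> f (extremal_F3 \<alpha> \<gamma>)"
      using extremal_F3_sharp(1)[OF alpha \<gamma>(1) lu u \<gamma>(2)] by blast
    show ?thesis
      using f half lh extremal_F3_sharp(2)[OF alpha \<gamma>(1) lu u \<gamma>(2) _ lh] False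
      by (intro exI[of _ f] exI[of _ "extremal_F3 \<alpha> \<gamma>"] exI[of _ "(1 / 2) *\<^sub>R u"] bexI[of _ lu]) auto
  qed
qed (use alpha in \<open>blast intro: starlike_bound_small starlike_bound_large q5_q6_regions
    extremal_F2_sharp extremal_F3_sharp\<close>)+

end
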